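(* Let $\mu:=\nu_u$ be a free Gibbs measure supported on $[-2,2]$ with $u''(x)\ge 1$ for all $x\in\mathbb{R}$, and suppose that $\mu$ is centered and of variance $1$. If the (optimal) transport map $T$ which sends the standard semicircular law $\eta$ to $\mu$ is $\mathcal{C}^3$, then $\mu=\eta$.
   Context: The standard semicircular distribution is $\eta(dx)=\frac1{2\pi}\sqrt{4-x^2}\,dx$ on $[-2,2]$. For a convex function $u:\mathbb{R}\to\mathbb{R}$, the free Gibbs measure $\nu_u$ is the unique minimizer, over Borel probability measures $\rho$ on $\mathbb{R}$, of $-\iint\log|t-s|\,d\rho(t)\,d\rho(s)+\int u(s)\,d\rho(s)$. The transport map is the Brenier map for the quadratic cost $|x-y|^2$ (the nondecreasing map with $T_\sharp\eta=\mu$). *)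

theory Defs
  imports "HOL-Probability.Probability"
begin

definition semicircle :: "real measure" where
  "semicircle = density lborel
     (\<lambda>x. ennreal (indicator {-2..2} x * (sqrt (4 - x\<^sup>2) / (2 * pi))))"

definition borel_prob_measures :: "real measure set" where
  "borel_prob_measures = {\<rho>. prob_space \<rho> \<and> sets \<rho> = sets borel}"

text \<open>
  Integral with values in the extended reals: the integral of the positive part minus that of
  the negative part (\<^const>\<open>e2ennreal\<close> sends negative numbers to 0).  Since
  \<^term>\<open>\<infinity> - \<infinity> = (\<infinity> :: ereal)\<close>, an undetermined integral is \<^term>\<open>\<infinity> :: ereal\<close>.
\<close>
definition ext_integral :: "'a measure \<Rightarrow> ('a \<Rightarrow> ereal) \<Rightarrow> ereal" where
  "ext_integral M f =
     enn2ereal (\<integral>\<^sup>+ x. e2ennreal (f x) \<partial>M) - enn2ereal (\<integral>\<^sup>+ x. e2ennreal (- f x) \<partial>M)"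

text \<open>
  The value on the diagonal has to be given separately, because \<^term>\<open>ln (0 :: real) = 0\<close>.
\<close>
definition neg_log_dist :: "real \<Rightarrow> real \<Rightarrow> ereal" where
  "neg_log_dist t s = (if t = s then \<infinity> else ereal (- ln \<bar>t - s\<bar>))"

text \<open>
  The convention \<^term>\<open>\<infinity> - \<infinity> = (\<infinity> :: ereal)\<close> also applies to the sum.  If
  \<open>u x \<ge> c * ln (1 + \<bar>x\<bar>) - C\<close> for some \<open>c > 2\<close> (in particular if the second derivative of \<open>u\<close> is
  at least 1), the functional agrees with the integral over \<open>\<rho> \<Otimes>\<^sub>M \<rho>\<close> of the single kernel
  \<open>(u t + u s) / 2 - ln \<bar>t - s\<bar>\<close>, which is bounded below.
\<close>
definition free_energy :: "(real \<Rightarrow> real) \<Rightarrow> real measure \<Rightarrow> ereal" where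
  "free_energy u \<rho> =
     ext_integral (\<rho> \<Otimes>\<^sub>M \<rho>) (\<lambda>(t, s). neg_log_dist t s) + ext_integral \<rho> (\<lambda>s. ereal (u s))"

definition is_energy_minimizer :: "(real \<Rightarrow> real) \<Rightarrow> real measure \<Rightarrow> bool" where
  "is_energy_minimizer u \<nu> \<longleftrightarrow>
     \<nu> \<in> borel_prob_measures \<and>
     (\<forall>\<rho> \<in> borel_prob_measures. free_energy u \<nu> \<le> free_energy u \<rho>)"

definition is_free_gibbs_measure :: "(real \<Rightarrow> real) \<Rightarrow> real measure \<Rightarrow> bool" where
  "is_free_gibbs_measure u \<nu> \<longleftrightarrow>
     is_energy_minimizer u \<nu> \<and> (\<forall>\<rho>. is_energy_minimizer u \<rho> \<longrightarrow> \<rho> = \<nu>)"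

definition is_transport_map :: "real measure \<Rightarrow> real measure \<Rightarrow> (real \<Rightarrow> real) \<Rightarrow> bool" where
  "is_transport_map M N T \<longleftrightarrow> T \<in> measurable M borel \<and> distr M borel T = N"

text \<open>
  A Brenier map is determined only up to null sets of the source measure, and values off the
  support are irrelevant; hence monotonicity is required on a set of full measure.
\<close>
definition is_brenier_map :: "real measure \<Rightarrow> real measure \<Rightarrow> (real \<Rightarrow> real) \<Rightarrow> bool" where
  "is_brenier_map M N T \<longleftrightarrow>
     is_transport_map M N T \<and>
     (\<forall>S. is_transport_map M N S \<longrightarrow>
        (\<integral>\<^sup>+ x. ennreal (\<bar>x - T x\<bar>\<^sup>2) \<partial>M) \<le> (\<integral>\<^sup>+ x. ennreal (\<bar>x - S x\<bar>\<^sup>2) \<partial>M)) \<and>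
     (\<exists>A. (AE x in M. x \<in> A) \<and> mono_on A T)"

text \<open>Meant for open \<open>S\<close>.\<close>
definition C3_on :: "real set \<Rightarrow> (real \<Rightarrow> real) \<Rightarrow> bool" where
  "C3_on S T \<longleftrightarrow> (\<exists>T1 T2 T3.
     (\<forall>x \<in> S. (T has_real_derivative T1 x) (at x) \<and>
              (T1 has_real_derivative T2 x) (at x) \<and>
              (T2 has_real_derivative T3 x) (at x)) \<and>
     continuous_on S T3)"

end

theory Submission
  imports Defs "HOL-Computational_Algebra.Formal_Power_Series"
begin

text \<open>
  Write \<open>\<eta>\<close> for the semicircular law.  The proof plays the Schwinger--Dyson equation of \<open>\<mu>\<close>
  against that of \<open>\<eta>\<close>, both tested along the monotone map \<open>T\<close>.

  A minimizer is stationary under displacements.  Moving the law of \<open>X\<close> to that of \<open>X + \<epsilon> Y\<close>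
  multiplies the distance of two points by \<open>1 + \<epsilon> q\<close>, where \<open>q\<close> is the difference quotient of \<open>Y\<close>
  against \<open>X\<close>; so the logarithmic energy changes by the integral of \<open>- ln (1 + \<epsilon> q)\<close> and
  minimality gives, for \<open>\<epsilon> \<down> 0\<close>,
  \<open>\<integral>\<integral> (Y x - Y y) / (X x - X y) \<le> \<integral> u'(X) Y\<close>
  (lemma \<open>minimizer_first_variation\<close>).  Applied to constant \<open>Y\<close> and to \<open>Y = - X\<close> it yields
  \<open>\<integral> u' d\<mu> = 0\<close> and \<open>\<integral> t u'(t) d\<mu> \<le> 1\<close>.  As \<open>\<mu>\<close> is centered with variance 1, the function
  \<open>g(t) = u'(t) - t\<close>, which is nondecreasing because \<open>u'' \<ge> 1\<close>, satisfies \<open>\<integral> g d\<mu> = 0\<close> and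
  \<open>\<integral> t g(t) d\<mu> \<le> 0\<close>.  But \<open>t (g(t) - g(0))\<close> is nonnegative, so \<open>g\<close> vanishes
  \<open>\<mu>\<close>-almost everywhere (lemma \<open>minimizer_potential_gradient\<close>): the potential looks quadratic to
  \<open>\<mu>\<close>.

  With \<open>X = T\<close> and \<open>Y x = x\<close> on the space \<open>\<eta>\<close>, the first variation now reads
  \<open>\<integral>\<integral> (x - y) / (T x - T y) \<le> \<integral> x T x\<close>.  Conversely
  \<open>\<integral>\<integral> (T x - T y) / (x - y) \<le> \<integral> x T x\<close> by the Schwinger--Dyson equation of \<open>\<eta>\<close>
  (lemma \<open>semicircle_Schwinger_Dyson_mono\<close>).  That equation is Segner's recurrence for the Catalan
  numbers when tested on monomials, and passes to \<open>C\<^sup>1\<close> functions by polynomial approximation of the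
  derivative.

  Since \<open>a + 1 / a \<ge> 2\<close> for \<open>a > 0\<close>, adding both inequalities gives \<open>\<integral> x T x \<ge> 1\<close>.  The maps
  \<open>T\<close> and \<open>x \<mapsto> x\<close> both have norm 1 in \<open>L\<^sup>2(\<eta>)\<close>, so equality in Cauchy--Schwarz forces \<open>T x = x\<close>
  almost everywhere.
\<close>

section \<open>Independent pairs and bounded random variables\<close>

lemma prob_space_pair_self:
  assumes "prob_space M" shows "prob_space (M \<Otimes>\<^sub>M M)"
proof -
  interpret prob_space M by fact
  interpret pair_prob_space M M ..
  show ?thesis by unfold_locales
qed

lemma distr_pair_self:
  assumes "prob_space M"
  shows "distr (M \<Otimes>\<^sub>M M) M fst = M" "distr (M \<Otimes>\<^sub>M M) M snd = M"
proof -
  interpret prob_space M by fact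
  show "distr (M \<Otimes>\<^sub>M M) M fst = M" by (rule distr_pair_fst)
  show "distr (M \<Otimes>\<^sub>M M) M snd = M"
  proof (rule measure_eqI)
    fix A assume "A \<in> sets (distr (M \<Otimes>\<^sub>M M) M snd)"
    then have A: "A \<in> sets M" by simp
    then have "emeasure (distr (M \<Otimes>\<^sub>M M) M snd) A = emeasure (M \<Otimes>\<^sub>M M) (space M \<times> A)"
      by (auto simp: emeasure_distr space_pair_measure dest: sets.sets_into_space
          intro!: arg_cong2[where f = emeasure])
    with A show "emeasure (distr (M \<Otimes>\<^sub>M M) M snd) A = emeasure M A"
      by (simp add: emeasure_pair_measure_Times emeasure_space_1)
  qed simp
qed

lemma AE_pair_self:
  assumes "prob_space M" "AE x in M. P x"
  shows "AE z in M \<Otimes>\<^sub>M M. P (fst z) \<and> P (snd z)"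
proof -
  have "AE z in M \<Otimes>\<^sub>M M. P (fst z)"
    by (rule AE_distrD[where M'=M and f=fst]) (simp_all only: distr_pair_self assms measurable_fst)
  moreover have "AE z in M \<Otimes>\<^sub>M M. P (snd z)"
    by (rule AE_distrD[where M'=M and f=snd]) (simp_all only: distr_pair_self assms measurable_snd)
  ultimately show ?thesis by eventually_elim simp
qed

section \<open>The free energy of the law of a random variable\<close>

lemma ext_integral_distr:
  assumes [measurable]: "X \<in> measurable M N" "f \<in> borel_measurable N"
  shows "ext_integral (distr M N X) f = ext_integral M (\<lambda>x. f (X x))"
  unfolding ext_integral_def by (simp add: nn_integral_distr)

lemma ext_integral_cong_AE:
  assumes "AE x in M. f x = g x"
  shows "ext_integral M f = ext_integral M g"
proof -
  have "(\<integral>\<^sup>+ x. e2ennreal (f x) \<partial>M) = (\<integral>\<^sup>+ x. e2ennreal (g x) \<partial>M)"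
    by (rule nn_integral_cong_AE) (use assms in eventually_elim, simp)
  moreover have "(\<integral>\<^sup>+ x. e2ennreal (- f x) \<partial>M) = (\<integral>\<^sup>+ x. e2ennreal (- g x) \<partial>M)"
    by (rule nn_integral_cong_AE) (use assms in eventually_elim, simp)
  ultimately show ?thesis unfolding ext_integral_def by simp
qed

text \<open>
  For integrable functions the convention for \<open>\<infinity> - \<infinity>\<close> never comes into play.
\<close>
lemma ext_integral_ereal:
  assumes "integrable M f"
  shows "ext_integral M (\<lambda>x. ereal (f x)) = ereal (\<integral>x. f x \<partial>M)"
proof -
  have fin: "(\<integral>\<^sup>+ x. ennreal (f x) \<partial>M) \<noteq> \<infinity>" "(\<integral>\<^sup>+ x. ennreal (- f x) \<partial>M) \<noteq> \<infinity>"
    using assms unfolding real_integrable_def by auto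
  have e: "enn2ereal a = ereal (enn2real a)" if "a \<noteq> \<infinity>" for a
    using that by (cases a) auto
  show ?thesis
    unfolding ext_integral_def real_lebesgue_integral_def[OF assms]
    using e[OF fin(1)] e[OF fin(2)] by simp
qed

lemma measurable_neg_log_dist [measurable]:
  "(\<lambda>(t, s). neg_log_dist t s) \<in> borel_measurable (borel \<Otimes>\<^sub>M borel)"
  unfolding neg_log_dist_def by measurable

text \<open>
  Energies of image measures are pulled back to the source, so that a perturbation of a measure
  becomes a perturbation of a function on a fixed probability space.
\<close>
lemma neg_log_energy_distr:
  fixes X :: "'a \<Rightarrow> real"
  assumes "prob_space M" and [measurable]: "X \<in> borel_measurable M"
  shows "ext_integral (distr M borel X \<Otimes>\<^sub>M distr M borel X) (\<lambda>(t, s). neg_log_dist t s) =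
    ext_integral (M \<Otimes>\<^sub>M M) (\<lambda>z. neg_log_dist (X (fst z)) (X (snd z)))"
proof -
  interpret prob_space M by fact
  interpret D: prob_space "distr M borel X" by (rule prob_space_distr) simp
  have "distr M borel X \<Otimes>\<^sub>M distr M borel X =
      distr (M \<Otimes>\<^sub>M M) (borel \<Otimes>\<^sub>M borel) (\<lambda>(x, y). (X x, X y))"
    by (rule pair_measure_distr) (auto intro: D.sigma_finite_measure_axioms)
  then show ?thesis
    by (simp add: ext_integral_distr) (simp add: case_prod_beta)
qed

lemma integrable_bounded_AE:
  fixes f :: "'a \<Rightarrow> real"
  assumes "prob_space M" "f \<in> borel_measurable M" "AE x in M. \<bar>f x\<bar> \<le> B"
  shows "integrable M f"
proof -
  interpret prob_space M by fact
  show ?thesis by (rule integrable_const_bound[where B=B]) (use assms in auto)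
qed

lemma DERIV_imp_continuous_on:
  fixes f f' :: "real \<Rightarrow> real"
  assumes "\<And>x. x \<in> S \<Longrightarrow> (f has_real_derivative f' x) (at x)"
  shows "continuous_on S f"
  using assms by (intro continuous_at_imp_continuous_on ballI DERIV_isCont)

lemma continuous_on_compact_abs_bound:
  fixes f :: "'a::topological_space \<Rightarrow> real"
  assumes "compact S" "continuous_on S f"
  shows "\<exists>B. \<forall>x\<in>S. \<bar>f x\<bar> \<le> B"
  using compact_imp_bounded[OF compact_continuous_image[OF assms(2,1)]]
  by (auto simp: bounded_real)

lemma integrable_continuous_bounded:
  fixes u :: "real \<Rightarrow> real"
  assumes "prob_space M" and [measurable]: "X \<in> borel_measurable M"
    and "AE x in M. \<bar>X x\<bar> \<le> R" "continuous_on UNIV u"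
  shows "integrable M (\<lambda>x. u (X x))"
proof -
  have [measurable]: "u \<in> borel_measurable borel"
    using assms(4) by (rule borel_measurable_continuous_onI)
  obtain B where B: "\<forall>y\<in>{-R..R}. \<bar>u y\<bar> \<le> B"
    using continuous_on_compact_abs_bound[OF compact_Icc continuous_on_subset[OF assms(4)]] by blast
  have "AE x in M. \<bar>u (X x)\<bar> \<le> B"
    using assms(3) by eventually_elim (use B in \<open>simp add: abs_le_iff\<close>)
  then show ?thesis by (intro integrable_bounded_AE[OF assms(1)]) simp_all
qed

lemma free_energy_distr:
  fixes X :: "'a \<Rightarrow> real"
  assumes "prob_space M" and [measurable]: "X \<in> borel_measurable M"
    and "AE x in M. \<bar>X x\<bar> \<le> R" "continuous_on UNIV u"
    and "AE z in M \<Otimes>\<^sub>M M. X (fst z) \<noteq> X (snd z)"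
    and int: "integrable (M \<Otimes>\<^sub>M M) (\<lambda>z. ln \<bar>X (fst z) - X (snd z)\<bar>)"
  shows "free_energy u (distr M borel X) =
    ereal ((\<integral>x. u (X x) \<partial>M) - (\<integral>z. ln \<bar>X (fst z) - X (snd z)\<bar> \<partial>(M \<Otimes>\<^sub>M M)))"
proof -
  have [measurable]: "u \<in> borel_measurable borel"
    using assms(4) by (rule borel_measurable_continuous_onI)
  have "ext_integral (M \<Otimes>\<^sub>M M) (\<lambda>z. neg_log_dist (X (fst z)) (X (snd z))) =
      ext_integral (M \<Otimes>\<^sub>M M) (\<lambda>z. ereal (- ln \<bar>X (fst z) - X (snd z)\<bar>))"
    by (rule ext_integral_cong_AE) (use assms(5) in eventually_elim, simp add: neg_log_dist_def)
  also have "\<dots> = ereal (\<integral>z. - ln \<bar>X (fst z) - X (snd z)\<bar> \<partial>(M \<Otimes>\<^sub>M M))"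
    by (intro ext_integral_ereal Bochner_Integration.integrable_minus int)
  moreover have "ext_integral (distr M borel X) (\<lambda>s. ereal (u s)) = ereal (\<integral>x. u (X x) \<partial>M)"
    by (simp add: ext_integral_distr
        ext_integral_ereal[OF integrable_continuous_bounded[OF assms(1-4)]])
  ultimately show ?thesis
    unfolding free_energy_def neg_log_energy_distr[OF assms(1,2)] by simp
qed

text \<open>
  The kernel is infinite on the diagonal, so finite energy rules out atoms; on a bounded support
  its negative part is bounded, so finiteness of the energy is integrability of the logarithm.
\<close>
lemma finite_free_energyD:
  fixes X :: "'a \<Rightarrow> real"
  assumes "prob_space M" and [measurable]: "X \<in> borel_measurable M"
    and bd: "AE x in M. \<bar>X x\<bar> \<le> R" and cont: "continuous_on UNIV u"
    and fin: "free_energy u (distr M borel X) \<noteq> \<infinity>"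
  shows "AE z in M \<Otimes>\<^sub>M M. X (fst z) \<noteq> X (snd z)"
    and "integrable (M \<Otimes>\<^sub>M M) (\<lambda>z. ln \<bar>X (fst z) - X (snd z)\<bar>)"
proof -
  interpret P: prob_space "M \<Otimes>\<^sub>M M" by (rule prob_space_pair_self) fact
  let ?k = "\<lambda>z. neg_log_dist (X (fst z)) (X (snd z))"
  have [measurable]: "u \<in> borel_measurable borel"
    using cont by (rule borel_measurable_continuous_onI)
  have [measurable]: "?k \<in> borel_measurable (M \<Otimes>\<^sub>M M)"
    unfolding neg_log_dist_def by measurable
  have bd2: "AE z in M \<Otimes>\<^sub>M M. \<bar>X (fst z) - X (snd z)\<bar> \<le> 2 * R"
    using AE_pair_self[OF assms(1) bd] by eventually_elim auto
  have k_lower: "AE z in M \<Otimes>\<^sub>M M. - ?k z \<le> ereal (ln (2 * R))"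
    using bd2
  proof eventually_elim
    case (elim z)
    then have "X (fst z) \<noteq> X (snd z) \<Longrightarrow> ln \<bar>X (fst z) - X (snd z)\<bar> \<le> ln (2 * R)"
      by (subst ln_le_cancel_iff) auto
    then show ?case by (auto simp: neg_log_dist_def)
  qed
  have "(\<integral>\<^sup>+ z. e2ennreal (- ?k z) \<partial>(M \<Otimes>\<^sub>M M)) \<le> (\<integral>\<^sup>+ z. ennreal (ln (2 * R)) \<partial>(M \<Otimes>\<^sub>M M))"
    by (intro nn_integral_mono_AE) (use k_lower in eventually_elim, metis e2ennreal_mono e2ennreal_ereal)
  also have "\<dots> < \<infinity>" by (simp add: P.emeasure_space_1 ennreal_mult_less_top)
  finally have neg: "(\<integral>\<^sup>+ z. e2ennreal (- ?k z) \<partial>(M \<Otimes>\<^sub>M M)) < \<infinity>" .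
  have pot: "ext_integral (distr M borel X) (\<lambda>s. ereal (u s)) = ereal (\<integral>x. u (X x) \<partial>M)"
    by (simp add: ext_integral_distr
        ext_integral_ereal[OF integrable_continuous_bounded[OF assms(1-4)]])
  have pos: "(\<integral>\<^sup>+ z. e2ennreal (?k z) \<partial>(M \<Otimes>\<^sub>M M)) \<noteq> \<infinity>"
  proof
    assume "(\<integral>\<^sup>+ z. e2ennreal (?k z) \<partial>(M \<Otimes>\<^sub>M M)) = \<infinity>"
    then have "ext_integral (M \<Otimes>\<^sub>M M) ?k = \<infinity>"
      unfolding ext_integral_def by simp
    then show False
      using fin unfolding free_energy_def neg_log_energy_distr[OF assms(1,2)] pot by simp
  qed
  show ne: "AE z in M \<Otimes>\<^sub>M M. X (fst z) \<noteq> X (snd z)"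
  proof -
    have "AE z in M \<Otimes>\<^sub>M M. e2ennreal (?k z) \<noteq> \<infinity>"
      by (rule nn_integral_PInf_AE[OF _ pos]) simp
    then show ?thesis by eventually_elim (auto simp: neg_log_dist_def)
  qed
  have "(\<integral>\<^sup>+ z. e2ennreal (?k z) \<partial>(M \<Otimes>\<^sub>M M)) = (\<integral>\<^sup>+ z. ennreal (- ln \<bar>X (fst z) - X (snd z)\<bar>) \<partial>(M \<Otimes>\<^sub>M M))"
    by (rule nn_integral_cong_AE) (use ne in eventually_elim, simp add: neg_log_dist_def)
  moreover have "(\<integral>\<^sup>+ z. e2ennreal (- ?k z) \<partial>(M \<Otimes>\<^sub>M M)) = (\<integral>\<^sup>+ z. ennreal (ln \<bar>X (fst z) - X (snd z)\<bar>) \<partial>(M \<Otimes>\<^sub>M M))"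
    by (rule nn_integral_cong_AE) (use ne in eventually_elim, simp add: neg_log_dist_def)
  ultimately show "integrable (M \<Otimes>\<^sub>M M) (\<lambda>z. ln \<bar>X (fst z) - X (snd z)\<bar>)"
    using pos neg unfolding real_integrable_def by simp
qed

section \<open>First variation of the free energy\<close>

text \<open>
  Fatou's lemma for real integrals, with the bound \<open>a n\<close> on the integrals allowed to converge.  It
  is applied to quotients with a constant lower bound but, a priori, no integrable upper bound.
\<close>
lemma Fatou_bounded_below:
  fixes f :: "nat \<Rightarrow> 'a \<Rightarrow> real"
  assumes "prob_space M" and int: "\<And>n. integrable M (f n)"
    and [measurable]: "g \<in> borel_measurable M"
    and lower: "\<And>n. AE x in M. - c \<le> f n x"
    and conv: "AE x in M. (\<lambda>n. f n x) \<longlonglongrightarrow> g x"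
    and le: "\<And>n. (\<integral>x. f n x \<partial>M) \<le> a n" and a: "a \<longlonglongrightarrow> b"
  shows "integrable M g" "(\<integral>x. g x \<partial>M) \<le> b"
proof -
  interpret prob_space M by fact
  have [measurable]: "f n \<in> borel_measurable M" for n using int by auto
  have all_lower: "AE x in M. \<forall>n. - c \<le> f n x"
    using lower by (simp add: AE_all_countable)
  have g_lower: "AE x in M. 0 \<le> g x + c"
    using all_lower conv
  proof eventually_elim
    case (elim x)
    then have "- c \<le> g x" by (intro LIMSEQ_le_const[of "\<lambda>n. f n x"]) auto
    then show ?case by simp
  qed
  have int_c: "integrable M (\<lambda>x. f n x + c)" for n
    using int by simp
  have int_eq: "(\<integral>x. f n x + c \<partial>M) = (\<integral>x. f n x \<partial>M) + c" for n
    using int by (simp add: prob_space)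
  have nn: "0 \<le> (\<integral>x. f n x + c \<partial>M)" for n
    by (rule integral_nonneg_AE) (use lower[of n] in eventually_elim, simp)
  have b: "0 \<le> b + c"
  proof (rule LIMSEQ_le_const)
    show "(\<lambda>n. a n + c) \<longlonglongrightarrow> b + c" using a by (intro tendsto_intros)
    have "0 \<le> a n + c" for n using nn[of n] le[of n] int_eq[of n] by linarith
    then show "\<exists>N. \<forall>n\<ge>N. 0 \<le> a n + c" by blast
  qed
  have "(\<integral>\<^sup>+ x. ennreal (g x + c) \<partial>M) = (\<integral>\<^sup>+ x. liminf (\<lambda>n. ennreal (f n x + c)) \<partial>M)"
  proof (rule nn_integral_cong_AE, use conv in eventually_elim)
    case (elim x)
    then have "(\<lambda>n. ennreal (f n x + c)) \<longlonglongrightarrow> ennreal (g x + c)" by (intro tendsto_intros)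
    then show ?case by (simp add: lim_imp_Liminf)
  qed
  also have "\<dots> \<le> liminf (\<lambda>n. \<integral>\<^sup>+ x. ennreal (f n x + c) \<partial>M)"
    by (rule nn_integral_liminf) simp
  also have "\<dots> \<le> liminf (\<lambda>n. ennreal (a n + c))"
  proof (rule Liminf_mono, rule always_eventually, rule allI)
    fix n
    have "(\<integral>\<^sup>+ x. ennreal (f n x + c) \<partial>M) = ennreal (\<integral>x. f n x + c \<partial>M)"
      by (rule nn_integral_eq_integral[OF int_c]) (use lower[of n] in eventually_elim, simp)
    also have "\<dots> \<le> ennreal (a n + c)"
      using le[of n] by (intro ennreal_leI) (simp add: int_eq)
    finally show "(\<integral>\<^sup>+ x. ennreal (f n x + c) \<partial>M) \<le> ennreal (a n + c)" .
  qed
  also have "\<dots> = ennreal (b + c)"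
    by (intro lim_imp_Liminf tendsto_intros a) simp
  finally have bound: "(\<integral>\<^sup>+ x. ennreal (g x + c) \<partial>M) \<le> ennreal (b + c)" .
  have int_g: "integrable M (\<lambda>x. g x + c)"
    by (rule integrableI_nonneg) (use g_lower bound in \<open>auto simp: le_less_trans\<close>)
  then have "integrable M (\<lambda>x. g x + c - c)" by (rule Bochner_Integration.integrable_diff) simp
  then show "integrable M g" by simp
  have "ennreal (\<integral>x. g x + c \<partial>M) \<le> ennreal (b + c)"
    using bound nn_integral_eq_integral[OF int_g g_lower] by simp
  then have "(\<integral>x. g x + c \<partial>M) \<le> b + c"
    using b by (simp add: ennreal_le_iff)
  with \<open>integrable M g\<close> show "(\<integral>x. g x \<partial>M) \<le> b" by (simp add: prob_space)
qed

text \<open>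
  The logarithmic singularity is dominated by one whose integral is elementary.
\<close>
lemma abs_ln_le_powr:
  fixes s :: real
  assumes "0 \<le> s" "s \<le> 1"
  shows "\<bar>ln s\<bar> \<le> 2 * s powr (- 1 / 2)"
proof (cases "s = 0")
  case False
  then have s: "0 < s" using assms by simp
  then have "ln (s powr (- 1 / 2)) \<le> s powr (- 1 / 2) - 1" by (intro ln_le_minus_one) simp
  then have "- ln s \<le> 2 * s powr (- 1 / 2)" using s by (simp add: ln_powr)
  moreover have "ln s \<le> 0" using s assms by simp
  ultimately show ?thesis by simp
qed simp

text \<open>
  The uniform law on the unit interval is a competitor of finite energy: its potential for the
  kernel \<open>2 \<bar>s\<bar>\<^sup>-\<^sup>1\<^sup>/\<^sup>2\<close>, which dominates the logarithm, is bounded by 8.  Hence minimizers have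
  finite energy.
\<close>
lemma ex_finite_free_energy:
  assumes cont: "continuous_on UNIV u"
  shows "\<exists>\<rho>\<in>borel_prob_measures. free_energy u \<rho> < \<infinity>"
proof
  define M :: "real measure" where "M = density lborel (\<lambda>x. indicator {0..1} x)"
  have p: "prob_space M"
    by (rule prob_spaceI) (simp add: M_def emeasure_density)
  interpret prob_space M by fact
  interpret P: pair_prob_space M M ..
  have [measurable_cong, simp]: "sets M = sets borel" by (simp add: M_def)
  have M01: "AE x in M. x \<in> {0..1}"
    unfolding M_def by (subst AE_density) (auto simp: indicator_def)
  have distr: "distr M borel (\<lambda>x. x) = M" by (rule distr_id2) simp
  show "M \<in> borel_prob_measures"
    by (simp add: borel_prob_measures_def p)
  define k :: "real \<Rightarrow> real" where "k = (\<lambda>s. 2 * \<bar>s\<bar> powr (- 1 / 2))"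
  have [measurable]: "k \<in> borel_measurable borel" unfolding k_def by measurable
  have half: "(\<integral>\<^sup>+ s. ennreal (k s) * indicator {0..1} s \<partial>lborel) = 4"
  proof -
    have "((\<lambda>s::real. s powr (- 1 / 2)) has_integral 2) {0..1}"
      using has_integral_powr_from_0[of "- 1 / 2" 1] by simp
    then have "((\<lambda>s. 2 * s powr (- 1 / 2)) has_integral 2 * 2) {0..1::real}"
      by (rule has_integral_mult_right)
    then have "(k has_integral 4) {0..1}"
      by (rule has_integral_eq_rhs[OF has_integral_eq[rotated]]) (simp_all add: k_def)
    then show ?thesis
      by (subst nn_integral_has_integral_lebesgue') (auto simp: k_def)
  qed
  have half': "(\<integral>\<^sup>+ s. ennreal (k s) * indicator {-1..0} s \<partial>lborel) = 4"
  proof -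
    have "(\<integral>\<^sup>+ s. ennreal (k s) * indicator {-1..0} s \<partial>lborel) =
        (\<integral>\<^sup>+ s. ennreal (k (- s)) * indicator {-1..0} (- s) \<partial>lborel)"
      by (subst nn_integral_real_affine[where c = "-1" and t = 0]) simp_all
    also have "\<dots> = (\<integral>\<^sup>+ s. ennreal (k s) * indicator {0..1} s \<partial>lborel)"
      by (intro nn_integral_cong) (auto simp: k_def indicator_def)
    finally show ?thesis using half by simp
  qed
  have potential: "(\<integral>\<^sup>+ y. ennreal (k (x - y)) \<partial>M) \<le> 8" if x: "x \<in> {0..1}" for x
  proof -
    have "(\<integral>\<^sup>+ y. ennreal (k (x - y)) \<partial>M) =
        (\<integral>\<^sup>+ y. indicator {0..1} y * ennreal (k (x - y)) \<partial>lborel)"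
      unfolding M_def by (subst nn_integral_density) auto
    also have "\<dots> = (\<integral>\<^sup>+ s. indicator {0..1} (x + s) * ennreal (k s) \<partial>lborel)"
      by (subst nn_integral_real_affine[where c = 1 and t = x]) (simp_all add: k_def)
    also have "\<dots> \<le> (\<integral>\<^sup>+ s. ennreal (k s) * indicator {0..1} s +
        ennreal (k s) * indicator {-1..0} s \<partial>lborel)"
      using x by (intro nn_integral_mono) (auto simp: indicator_def)
    also have "\<dots> = 8"
      by (subst nn_integral_add) (simp_all add: half half')
    finally show ?thesis .
  qed
  have close: "AE z in M \<Otimes>\<^sub>M M. \<bar>fst z - snd z\<bar> \<le> 1"
    using AE_pair_self[OF p M01] by eventually_elim auto
  have "(\<integral>\<^sup>+ z. ennreal (norm (ln \<bar>fst z - snd z\<bar>)) \<partial>(M \<Otimes>\<^sub>M M)) \<le>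
      (\<integral>\<^sup>+ z. ennreal (k (fst z - snd z)) \<partial>(M \<Otimes>\<^sub>M M))"
    by (intro nn_integral_mono_AE, use close in eventually_elim)
      (use abs_ln_le_powr in \<open>auto simp: k_def intro!: ennreal_leI\<close>)
  also have "\<dots> = (\<integral>\<^sup>+ x. \<integral>\<^sup>+ y. ennreal (k (x - y)) \<partial>M \<partial>M)"
    by (subst nn_integral_fst[symmetric]) simp_all
  also have "\<dots> \<le> (\<integral>\<^sup>+ x. 8 \<partial>M)"
    by (intro nn_integral_mono_AE, use M01 in eventually_elim) (rule potential)
  also have "\<dots> < \<infinity>" by (simp add: emeasure_space_1)
  finally have int: "integrable (M \<Otimes>\<^sub>M M) (\<lambda>z. ln \<bar>fst z - snd z\<bar>)"
    by (intro integrableI_bounded) simp_all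
  have "AE z in M \<Otimes>\<^sub>M M. fst z \<noteq> snd z"
  proof (rule P.AE_pair_measure)
    have "AE y in M. y \<noteq> x" for x
      unfolding M_def by (subst AE_density) (use AE_lborel_singleton[of x] in \<open>auto elim: AE_mp\<close>)
    then show "AE x in M. AE y in M. fst (x, y) \<noteq> snd (x, y)" by (simp add: eq_commute)
  qed measurable
  moreover have bd: "AE x in M. \<bar>x\<bar> \<le> 1" using M01 by eventually_elim auto
  ultimately have "free_energy u (distr M borel (\<lambda>x. x)) \<noteq> \<infinity>"
    by (subst free_energy_distr[OF p _ bd cont _ int]) simp_all
  then show "free_energy u M < \<infinity>" by (simp add: distr)
qed

text \<open>
  The energies of \<open>X\<close> and of \<open>X + e Y\<close> differ by the integral of \<open>ln (1 + e q)\<close> and a potential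
  term.  Only an inequality is obtained, because \<open>e\<close> has to be positive: a negative \<open>e\<close> would need
  \<open>q\<close> bounded above.  For the test functions used below, \<open>q\<close> is bounded below but may be
  unbounded above, so the limit \<open>e \<down> 0\<close> is taken with Fatou's lemma.
\<close>
lemma minimizer_first_variation:
  fixes X Y :: "'a \<Rightarrow> real" and u u' :: "real \<Rightarrow> real" and K :: real
  defines "q \<equiv> \<lambda>z. (Y (fst z) - Y (snd z)) / (X (fst z) - X (snd z))"
  assumes p: "prob_space M" and [measurable]: "X \<in> borel_measurable M" "Y \<in> borel_measurable M"
    and X: "AE x in M. \<bar>X x\<bar> \<le> R" and Y: "AE x in M. \<bar>Y x\<bar> \<le> S"
    and u: "\<And>x. (u has_real_derivative u' x) (at x)" and u': "continuous_on UNIV u'"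
    and min: "is_energy_minimizer u (distr M borel X)"
    and K: "0 \<le> K" and q: "AE z in M \<Otimes>\<^sub>M M. - K \<le> q z"
  shows "integrable (M \<Otimes>\<^sub>M M) q" "(\<integral>z. q z \<partial>(M \<Otimes>\<^sub>M M)) \<le> (\<integral>x. u' (X x) * Y x \<partial>M)"
proof -
  interpret prob_space M by fact
  interpret P: prob_space "M \<Otimes>\<^sub>M M" by (rule prob_space_pair_self) fact
  have cont: "continuous_on UNIV u"
    using u by (rule DERIV_imp_continuous_on)
  have [measurable]: "u \<in> borel_measurable borel" "u' \<in> borel_measurable borel"
    using cont u' by (auto intro: borel_measurable_continuous_onI)
  have [measurable]: "q \<in> borel_measurable (M \<Otimes>\<^sub>M M)" unfolding q_def by measurable
  have "free_energy u (distr M borel X) \<noteq> \<infinity>"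
    using ex_finite_free_energy[OF cont] min unfolding is_energy_minimizer_def by fastforce
  note fin = finite_free_energyD[OF p _ X cont this, simplified]
  note fin1 = fin(1) and fin2 = fin(2)
  \<comment> \<open>Minimality for one displacement of size \<open>e\<close>; the condition \<open>e * K \<le> 1 / 2\<close> keeps \<open>1 + e q\<close>
      away from 0.\<close>
  have quot: "integrable (M \<Otimes>\<^sub>M M) (\<lambda>z. ln (1 + e * q z)) \<and>
      (\<integral>z. ln (1 + e * q z) \<partial>(M \<Otimes>\<^sub>M M)) \<le> (\<integral>x. u (X x + e * Y x) - u (X x) \<partial>M) \<and>
      (AE z in M \<Otimes>\<^sub>M M. - (2 * K) * e \<le> ln (1 + e * q z))"
    if e: "0 < e" "e \<le> 1" "e * K \<le> 1 / 2" for e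
  proof -
    let ?Z = "\<lambda>x. X x + e * Y x"
    have Z: "AE x in M. \<bar>?Z x\<bar> \<le> R + S"
      using X Y
    proof eventually_elim
      case (elim x)
      have "\<bar>e * Y x\<bar> \<le> 1 * S"
        unfolding abs_mult using e elim by (intro mult_mono) auto
      then show ?case using elim by linarith
    qed
    have q': "AE z in M \<Otimes>\<^sub>M M. 1 / 2 \<le> 1 + e * q z \<and> - (2 * K) * e \<le> ln (1 + e * q z)"
      using q
    proof eventually_elim
      case (elim z)
      have eq: "- (e * K) \<le> e * q z" using mult_left_mono[OF elim, of e] e by simp
      have "- (e * K) - 2 * (e * K)\<^sup>2 \<le> ln (1 - e * K)"
        by (rule ln_one_minus_pos_lower_bound) (use e K in auto)
      moreover have "(e * K)\<^sup>2 \<le> (1 / 2) * (e * K)"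
        unfolding power2_eq_square by (rule mult_right_mono) (use e K in auto)
      moreover have "ln (1 - e * K) \<le> ln (1 + e * q z)"
        using eq e by (subst ln_le_cancel_iff) auto
      moreover have "- (2 * K) * e = - (e * K) - e * K" by simp
      ultimately show ?case using eq e by linarith
    qed
    \<comment> \<open>The logarithmic energy is additive under the displacement.\<close>
    have split: "AE z in M \<Otimes>\<^sub>M M. ?Z (fst z) \<noteq> ?Z (snd z) \<and>
        ln \<bar>?Z (fst z) - ?Z (snd z)\<bar> = ln \<bar>X (fst z) - X (snd z)\<bar> + ln (1 + e * q z)"
      using q' fin1
    proof eventually_elim
      case (elim z)
      have *: "?Z (fst z) - ?Z (snd z) = (X (fst z) - X (snd z)) * (1 + e * q z)"
        using elim by (simp add: q_def field_simps)
      have pos: "0 < 1 + e * q z" using elim by linarith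
      have "ln \<bar>?Z (fst z) - ?Z (snd z)\<bar> = ln (\<bar>X (fst z) - X (snd z)\<bar> * (1 + e * q z))"
        unfolding * abs_mult using pos by simp
      also have "\<dots> = ln \<bar>X (fst z) - X (snd z)\<bar> + ln (1 + e * q z)"
        using pos elim by (intro ln_mult_pos) auto
      moreover have "(X (fst z) - X (snd z)) * (1 + e * q z) \<noteq> 0"
        using pos elim by simp
      ultimately show ?case using * by (metis eq_iff_diff_eq_0)
    qed
    have intZ: "integrable (M \<Otimes>\<^sub>M M) (\<lambda>z. ln \<bar>?Z (fst z) - ?Z (snd z)\<bar>)"
    proof (rule Bochner_Integration.integrable_bound)
      show "integrable (M \<Otimes>\<^sub>M M) (\<lambda>z. \<bar>ln \<bar>X (fst z) - X (snd z)\<bar>\<bar> + (1 + 2 * (R + S)))"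
        using fin2 by (intro Bochner_Integration.integrable_add integrable_abs) simp_all
      show "AE z in M \<Otimes>\<^sub>M M. norm (ln \<bar>?Z (fst z) - ?Z (snd z)\<bar>) \<le>
          norm (\<bar>ln \<bar>X (fst z) - X (snd z)\<bar>\<bar> + (1 + 2 * (R + S)))"
        using q' split AE_pair_self[OF p Z]
      proof eventually_elim
        case (elim z)
        let ?D = "\<bar>?Z (fst z) - ?Z (snd z)\<bar>"
        have "ln ?D \<le> ?D"
          using elim by (intro order.trans[OF ln_le_minus_one]) auto
        moreover have D: "?D \<le> 2 * (R + S)"
          using elim(3) abs_triangle_ineq4[of "?Z (fst z)" "?Z (snd z)"] by argo
        ultimately have "ln ?D \<le> 2 * (R + S)" by simp
        moreover have "- 1 \<le> - (2 * K) * e" using e(3) by argo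
        then have "- 1 \<le> ln (1 + e * q z)" using elim(1) by simp
        moreover have "0 \<le> 2 * (R + S)" using D by (rule order.trans[OF abs_ge_zero])
        moreover have "norm l \<le> norm (\<bar>a\<bar> + (1 + c))"
          if "l = a + b" "l \<le> c" "- 1 \<le> b" "0 \<le> c" for a b c l :: real
          using that by simp
        ultimately show ?case using elim(2) by blast
      qed
    qed measurable
    have eqZ: "free_energy u (distr M borel ?Z) = ereal ((\<integral>x. u (?Z x) \<partial>M) -
        (\<integral>z. ln \<bar>?Z (fst z) - ?Z (snd z)\<bar> \<partial>(M \<Otimes>\<^sub>M M)))"
      by (rule free_energy_distr[OF p _ Z cont _ intZ]) (use split in \<open>auto elim: AE_mp\<close>)
    have eqX: "free_energy u (distr M borel X) = ereal ((\<integral>x. u (X x) \<partial>M) -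
        (\<integral>z. ln \<bar>X (fst z) - X (snd z)\<bar> \<partial>(M \<Otimes>\<^sub>M M)))"
      by (rule free_energy_distr[OF p _ X cont fin1 fin2]) simp
    have "distr M borel ?Z \<in> borel_prob_measures"
      unfolding borel_prob_measures_def by (auto intro!: prob_space_distr)
    then have le: "free_energy u (distr M borel X) \<le> free_energy u (distr M borel ?Z)"
      using min unfolding is_energy_minimizer_def by blast
    have diff: "AE z in M \<Otimes>\<^sub>M M.
        ln \<bar>?Z (fst z) - ?Z (snd z)\<bar> - ln \<bar>X (fst z) - X (snd z)\<bar> = ln (1 + e * q z)"
      using split by eventually_elim simp
    have int_ln: "integrable (M \<Otimes>\<^sub>M M) (\<lambda>z. ln (1 + e * q z))"
      by (rule integrable_cong_AE_imp[OF Bochner_Integration.integrable_diff[OF intZ fin2]])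
        (use diff in simp_all)
    have "(\<integral>z. ln (1 + e * q z) \<partial>(M \<Otimes>\<^sub>M M)) =
        (\<integral>z. ln \<bar>?Z (fst z) - ?Z (snd z)\<bar> - ln \<bar>X (fst z) - X (snd z)\<bar> \<partial>(M \<Otimes>\<^sub>M M))"
      by (rule integral_cong_AE) (use diff in \<open>auto elim: AE_mp\<close>)
    also have "\<dots> \<le> (\<integral>x. u (?Z x) - u (X x) \<partial>M)"
      using le unfolding eqX eqZ
      by (simp add: intZ fin2 integrable_continuous_bounded[OF p _ Z cont]
          integrable_continuous_bounded[OF p _ X cont])
    finally show ?thesis using int_ln q' by auto
  qed
  \<comment> \<open>These step sizes are admissible for every \<open>n\<close>, the first one included.\<close>
  define e where "e n = 1 / (2 * K + 1 + real n)" for n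
  have e: "0 < e n" "e n \<le> 1" "e n * K \<le> 1 / 2" for n
    using K unfolding e_def by (auto simp: divide_simps)
  have e0: "e \<longlonglongrightarrow> 0" unfolding e_def by real_asymp
  have e_at: "filterlim e (at 0) sequentially"
    using e0 e(1) by (auto simp: filterlim_at eventually_sequentially less_imp_neq[symmetric])
  note quot_e = quot[OF e]
  let ?f = "\<lambda>n z. ln (1 + e n * q z) / e n"
  let ?d = "\<lambda>n x. (u (X x + e n * Y x) - u (X x)) / e n"
  have lim_d: "(\<lambda>n. \<integral>x. ?d n x \<partial>M) \<longlonglongrightarrow> (\<integral>x. u' (X x) * Y x \<partial>M)"
  proof -
    obtain B where B: "\<forall>y\<in>{- (R + S)..R + S}. \<bar>u' y\<bar> \<le> B"
      using continuous_on_compact_abs_bound[OF compact_Icc continuous_on_subset[OF u']] by blast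
    show ?thesis
    proof (rule integral_dominated_convergence[where w = "\<lambda>_. B * S"])
      show "AE x in M. (\<lambda>n. ?d n x) \<longlonglongrightarrow> u' (X x) * Y x"
      proof (rule AE_I2)
        fix x
        have "((\<lambda>t. u (X x + t * Y x)) has_real_derivative u' (X x) * Y x) (at 0)"
          by (rule DERIV_chain2[where f = u and g = "\<lambda>t. X x + t * Y x"])
            (use u[of "X x"] in \<open>auto intro!: derivative_eq_intros\<close>)
        then have "((\<lambda>t. (u (X x + t * Y x) - u (X x)) / t) \<longlongrightarrow> u' (X x) * Y x) (at 0)"
          by (simp add: DERIV_def)
        from filterlim_compose[OF this e_at]
        show "(\<lambda>n. ?d n x) \<longlonglongrightarrow> u' (X x) * Y x" by simp
      qed
      show "AE x in M. norm (?d n x) \<le> B * S" for n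
        using X Y
      proof eventually_elim
        case (elim x)
        have "\<bar>e n * Y x\<bar> \<le> 1 * S"
          unfolding abs_mult using e[of n] elim by (intro mult_mono) auto
        then have mem: "X x + e n * Y x \<in> {- (R + S)..R + S}" "X x \<in> {- (R + S)..R + S}"
          using elim by (auto simp: abs_le_iff)
        have "norm (u (X x + e n * Y x) - u (X x)) \<le> B * norm ((X x + e n * Y x) - X x)"
          by (rule field_differentiable_bound[where S = "{- (R + S)..R + S}" and f' = u'])
            (use u B mem in \<open>auto intro: has_field_derivative_at_within\<close>)
        also have "\<dots> = B * (e n * \<bar>Y x\<bar>)" using e(1)[of n] by (simp add: abs_mult)
        also have "\<dots> \<le> B * (e n * S)"
          using B mem e(1)[of n] elim
          by (intro mult_left_mono) (auto intro: order.trans[OF abs_ge_zero])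
        finally show ?case using e(1)[of n] by (simp add: field_simps)
      qed
    qed simp_all
  qed
  have f_int: "integrable (M \<Otimes>\<^sub>M M) (?f n)" for n using quot_e[of n] by simp
  have f_lower: "AE z in M \<Otimes>\<^sub>M M. - (2 * K) \<le> ?f n z" for n
  proof -
    have "AE z in M \<Otimes>\<^sub>M M. - (2 * K) * e n \<le> ln (1 + e n * q z)" using quot_e[of n] by blast
    then show ?thesis by eventually_elim (use e(1)[of n] in \<open>simp add: field_simps\<close>)
  qed
  have "(\<lambda>n. ?f n z) \<longlonglongrightarrow> q z" for z
  proof -
    have "((\<lambda>t. ln (1 + t * q z)) has_real_derivative q z) (at 0)"
      by (auto intro!: derivative_eq_intros)
    then have "((\<lambda>t. ln (1 + t * q z) / t) \<longlongrightarrow> q z) (at 0)" by (simp add: DERIV_def)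
    from filterlim_compose[OF this e_at] show ?thesis by simp
  qed
  then have f_conv: "AE z in M \<Otimes>\<^sub>M M. (\<lambda>n. ?f n z) \<longlonglongrightarrow> q z" by simp
  have f_le: "(\<integral>z. ?f n z \<partial>(M \<Otimes>\<^sub>M M)) \<le> (\<integral>x. ?d n x \<partial>M)" for n
    using quot_e[of n] e(1)[of n] by (simp add: divide_right_mono)
  note Fatou = Fatou_bounded_below[OF P.prob_space_axioms f_int _ f_lower f_conv f_le lim_d]
  show "integrable (M \<Otimes>\<^sub>M M) q" "(\<integral>z. q z \<partial>(M \<Otimes>\<^sub>M M)) \<le> (\<integral>x. u' (X x) * Y x \<partial>M)"
    by (rule Fatou; measurable)+
qed

section \<open>Moments of the semicircular law\<close>

lemma DERIV_sqrt_4_minus_square: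
  fixes x :: real
  assumes "-2 < x" "x < 2"
  shows "0 < 4 - x\<^sup>2"
    and "((\<lambda>x. sqrt (4 - x\<^sup>2)) has_real_derivative - x / sqrt (4 - x\<^sup>2)) (at x)"
proof -
  show pos: "0 < 4 - x\<^sup>2"
    using mult_pos_pos[of "2 - x" "2 + x"] assms by (simp add: algebra_simps power2_eq_square)
  have "((\<lambda>x. 4 - x\<^sup>2) has_real_derivative - 2 * x) (at x)"
    by (auto intro!: derivative_eq_intros)
  from DERIV_chain2[OF DERIV_real_sqrt[OF pos] this]
  show "((\<lambda>x. sqrt (4 - x\<^sup>2)) has_real_derivative - x / sqrt (4 - x\<^sup>2)) (at x)"
    by (simp add: field_simps)
qed

lemma DERIV_semicircle_area:
  fixes x :: real
  assumes "-2 < x" "x < 2"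
  shows "((\<lambda>x. x / 2 * sqrt (4 - x\<^sup>2) + 2 * arcsin (x / 2)) has_real_derivative sqrt (4 - x\<^sup>2)) (at x)"
proof -
  define s where "s = sqrt (4 - x\<^sup>2)"
  have s: "s > 0" "s * s = 4 - x * x"
    using DERIV_sqrt_4_minus_square(1)[OF assms] by (simp_all add: s_def power2_eq_square)
  have e: "sqrt (1 - (x / 2)\<^sup>2) = s / 2"
    using s by (intro real_sqrt_unique) (simp_all add: power2_eq_square)
  have "((\<lambda>x. x / 2 * sqrt (4 - x\<^sup>2)) has_real_derivative s / 2 + x / 2 * (- x / s)) (at x)"
    using DERIV_mult[OF DERIV_cdivide[OF DERIV_ident, of 2 x UNIV] DERIV_sqrt_4_minus_square(2)[OF assms]]
    by (simp add: s_def algebra_simps)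
  moreover have "((\<lambda>x. 2 * arcsin (x / 2)) has_real_derivative 2 * (inverse (s / 2) * (1 / 2))) (at x)"
    unfolding e[symmetric]
    by (intro DERIV_cmult DERIV_chain2[OF DERIV_arcsin]) (use assms in \<open>auto intro!: derivative_eq_intros\<close>)
  ultimately have "((\<lambda>x. x / 2 * sqrt (4 - x\<^sup>2) + 2 * arcsin (x / 2)) has_real_derivative
      s / 2 + x / 2 * (- x / s) + 2 * (inverse (s / 2) * (1 / 2))) (at x)"
    by (rule DERIV_add)
  also have "s / 2 + x / 2 * (- x / s) + 2 * (inverse (s / 2) * (1 / 2)) = s"
    using s by (simp add: divide_simps)
  finally show ?thesis unfolding s_def .
qed
text \<open>
  An antiderivative that vanishes at \<open>\<plusminus> 2\<close>; integrating it over the support links the moments of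
  order \<open>k - 1\<close> and \<open>k + 1\<close>.
\<close>
lemma DERIV_power_times_semicircle:
  fixes x :: real
  assumes "-2 < x" "x < 2"
  shows "((\<lambda>x. x ^ k * ((4 - x\<^sup>2) * sqrt (4 - x\<^sup>2))) has_real_derivative
    (4 * real k * x ^ (k - 1) - (real k + 3) * x ^ (k + 1)) * sqrt (4 - x\<^sup>2)) (at x)"
proof -
  define s where "s = sqrt (4 - x\<^sup>2)"
  have s: "s > 0" "4 - x\<^sup>2 = s * s"
    using DERIV_sqrt_4_minus_square(1)[OF assms] by (simp_all add: s_def)
  have "((\<lambda>x. sqrt (4 - x\<^sup>2)) has_real_derivative - x / s) (at x)"
    unfolding s_def by (rule DERIV_sqrt_4_minus_square(2)[OF assms])
  then have "((\<lambda>x. (4 - x\<^sup>2) * sqrt (4 - x\<^sup>2)) has_real_derivative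
      - 2 * x * s + - x / s * (4 - x\<^sup>2)) (at x)"
    unfolding s_def by (rule DERIV_mult[rotated]) (auto intro!: derivative_eq_intros)
  also have "- 2 * x * s + - x / s * (4 - x\<^sup>2) = - 3 * x * s"
    using s(1) unfolding s(2) by simp
  finally have "((\<lambda>x. x ^ k * ((4 - x\<^sup>2) * sqrt (4 - x\<^sup>2))) has_real_derivative
      real k * x ^ (k - 1) * ((4 - x\<^sup>2) * s) + - 3 * x * s * x ^ k) (at x)"
    unfolding s_def by (rule DERIV_mult[rotated]) (auto intro!: derivative_eq_intros)
  also have "real k * x ^ (k - 1) * ((4 - x\<^sup>2) * s) + - 3 * x * s * x ^ k =
      (4 * real k * x ^ (k - 1) - (real k + 3) * x ^ (k + 1)) * s"
    by (cases k) (simp_all add: algebra_simps power2_eq_square)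
  finally show ?thesis unfolding s_def .
qed

lemma integral_semicircle:
  fixes f :: "real \<Rightarrow> real"
  assumes "continuous_on UNIV f"
  shows "(\<integral>x. f x \<partial>semicircle) = integral {-2..2} (\<lambda>x. f x * sqrt (4 - x\<^sup>2)) / (2 * pi)"
proof -
  have [measurable]: "f \<in> borel_measurable borel"
    using assms by (rule borel_measurable_continuous_onI)
  have "continuous_on {-2..2} (\<lambda>x. f x * sqrt (4 - x\<^sup>2))"
    by (intro continuous_intros continuous_on_subset[OF assms]) auto
  then have int: "set_integrable lborel {-2..2} (\<lambda>x. f x * sqrt (4 - x\<^sup>2))"
    by (rule borel_integrable_atLeastAtMost')
  have nn: "0 \<le> indicator {-2..2} x * (sqrt (4 - x\<^sup>2) / (2 * pi))" for x :: real
    using abs_le_square_iff[of x 2] by (auto simp: indicator_def abs_le_iff)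
  have "(\<integral>x. f x \<partial>semicircle) =
      (\<integral>x. (indicator {-2..2} x * (sqrt (4 - x\<^sup>2) / (2 * pi))) *\<^sub>R f x \<partial>lborel)"
    unfolding semicircle_def using nn by (intro integral_density) auto
  also have "\<dots> = (\<integral>x. indicator {-2..2} x *\<^sub>R (f x * sqrt (4 - x\<^sup>2)) / (2 * pi) \<partial>lborel)"
    by (intro Bochner_Integration.integral_cong) simp_all
  also have "\<dots> = (LINT x:{-2..2}|lborel. f x * sqrt (4 - x\<^sup>2)) / (2 * pi)"
    unfolding set_lebesgue_integral_def by simp
  also have "(LINT x:{-2..2}|lborel. f x * sqrt (4 - x\<^sup>2)) = integral {-2..2} (\<lambda>x. f x * sqrt (4 - x\<^sup>2))"
    by (rule set_borel_integral_eq_integral(2)[OF int])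
  finally show ?thesis .
qed

lemma sets_semicircle [measurable_cong, simp]: "sets semicircle = sets borel"
  by (simp add: semicircle_def)

lemma prob_space_semicircle: "prob_space semicircle"
proof (rule prob_spaceI)
  let ?F = "\<lambda>x. x / 2 * sqrt (4 - x\<^sup>2) + 2 * arcsin (x / 2) :: real"
  have "((\<lambda>x. sqrt (4 - x\<^sup>2)) has_integral (?F 2 - ?F (-2))) {-2..2}"
  proof (rule fundamental_theorem_of_calculus_interior)
    show "(?F has_vector_derivative sqrt (4 - x\<^sup>2)) (at x)" if "x \<in> {-2<..<2}" for x
      using DERIV_semicircle_area[of x] that
      by (simp add: has_real_derivative_iff_has_vector_derivative)
  qed (auto intro!: continuous_intros)
  then have "((\<lambda>x. sqrt (4 - x\<^sup>2) / (2 * pi)) has_integral (2 * pi / (2 * pi))) {-2..2::real}"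
    by (intro has_integral_divide) (simp add: arcsin_minus)
  then have I: "((\<lambda>x. sqrt (4 - x\<^sup>2) / (2 * pi)) has_integral 1) {-2..2::real}" by simp
  have "0 \<le> sqrt (4 - x\<^sup>2) / (2 * pi)" if "x \<in> {-2..2}" for x :: real
    using that abs_le_square_iff[of x 2] by (auto simp: abs_le_iff)
  from nn_integral_has_integral_lebesgue[OF this I]
  show "emeasure semicircle (space semicircle) = 1"
    unfolding semicircle_def by (simp add: emeasure_density)
qed

lemma AE_semicircle_iff:
  "(AE x in semicircle. P x) \<longleftrightarrow> (AE x in lborel. -2 < x \<and> x < 2 \<longrightarrow> P x)"
proof -
  have "0 < indicator {-2..2} x * (sqrt (4 - x\<^sup>2) / (2 * pi)) \<longleftrightarrow> -2 < x \<and> x < 2" for x :: real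
    using abs_square_less_1[of "x / 2"]
    by (auto simp: indicator_def power_divide field_simps abs_less_iff zero_less_mult_iff)
  then show ?thesis
    unfolding semicircle_def by (subst AE_density) auto
qed

lemma AE_semicircle_interval: "AE x in semicircle. -2 < x \<and> x < 2"
  by (simp add: AE_semicircle_iff)

text \<open>
  The density is positive inside the support, so a property that holds almost everywhere holds on a
  dense set.
\<close>
lemma semicircle_full_measure_dense:
  assumes "AE x in semicircle. P x" "-2 \<le> a" "a < b" "b \<le> 2"
  shows "\<exists>x. a < x \<and> x < b \<and> P x"
proof (rule ccontr)
  assume "\<not> ?thesis"
  then have "AE x in lborel. x \<notin> {a<..<b}"
    using assms(1) unfolding AE_semicircle_iff
    by (elim AE_mp) (use assms in auto)
  then have "emeasure lborel {a<..<b} = 0"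
    by (subst (asm) AE_iff_measurable[where N = "{a<..<b}"]) auto
  then show False using assms by simp
qed

lemma AE_semicircle_pair_distinct: "AE z in semicircle \<Otimes>\<^sub>M semicircle. fst z \<noteq> snd z"
proof -
  interpret prob_space semicircle by (rule prob_space_semicircle)
  interpret P: pair_prob_space semicircle semicircle ..
  show ?thesis
  proof (rule P.AE_pair_measure)
    have "AE y in semicircle. x \<noteq> y" for x
      unfolding AE_semicircle_iff using AE_lborel_singleton[of x] by eventually_elim auto
    then show "AE x in semicircle. AE y in semicircle. fst (x, y) \<noteq> snd (x, y)" by simp
  qed measurable
qed

lemma integrable_semicircle_continuous:
  fixes f :: "real \<Rightarrow> real"
  assumes "continuous_on UNIV f"
  shows "integrable semicircle f"
proof (rule integrable_continuous_bounded[OF prob_space_semicircle, where R = 2 and X = "\<lambda>x. x"])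
  show "AE x in semicircle. \<bar>x\<bar> \<le> 2"
    using AE_semicircle_interval by eventually_elim auto
qed (use assms in simp_all)

definition semicircle_moment :: "nat \<Rightarrow> real" where
  "semicircle_moment n = (\<integral>x. x ^ n \<partial>semicircle)"

text \<open>
  For \<open>k = 0\<close> the right-hand side vanishes, whatever the truncated exponent \<open>k - 1\<close> stands for, and
  the recurrence says that the first moment is 0.
\<close>
lemma semicircle_moment_recurrence:
  "(real k + 3) * semicircle_moment (k + 1) = 4 * real k * semicircle_moment (k - 1)"
proof -
  let ?F = "\<lambda>x::real. x ^ k * ((4 - x\<^sup>2) * sqrt (4 - x\<^sup>2))"
  let ?p = "\<lambda>x::real. 4 * real k * x ^ (k - 1) - (real k + 3) * x ^ (k + 1)"
  have "((\<lambda>x. ?p x * sqrt (4 - x\<^sup>2)) has_integral (?F 2 - ?F (-2))) {-2..2}"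
  proof (rule fundamental_theorem_of_calculus_interior)
    show "(?F has_vector_derivative ?p x * sqrt (4 - x\<^sup>2)) (at x)" if "x \<in> {-2<..<2}" for x
      using DERIV_power_times_semicircle[of x k] that
      by (simp add: has_real_derivative_iff_has_vector_derivative)
  qed (auto intro!: continuous_intros)
  then have "integral {-2..2} (\<lambda>x. ?p x * sqrt (4 - x\<^sup>2)) = 0"
    by (simp add: integral_unique)
  then have "(\<integral>x. ?p x \<partial>semicircle) = 0"
    by (subst integral_semicircle) (auto intro!: continuous_intros)
  moreover have "(\<integral>x. ?p x \<partial>semicircle) =
      4 * real k * semicircle_moment (k - 1) - (real k + 3) * semicircle_moment (k + 1)"
    unfolding semicircle_moment_def
    by (subst Bochner_Integration.integral_diff)
      (auto intro!: integrable_semicircle_continuous continuous_intros)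
  ultimately show ?thesis by simp
qed

lemma semicircle_moment_0 [simp]: "semicircle_moment 0 = 1"
  using prob_space.prob_space[OF prob_space_semicircle] by (simp add: semicircle_moment_def)

lemma semicircle_moment_1: "semicircle_moment (Suc 0) = 0"
  using semicircle_moment_recurrence[of 0] by simp

lemma semicircle_moment_2: "semicircle_moment 2 = 1"
  using semicircle_moment_recurrence[of 1] by (simp add: numeral_2_eq_2)

text \<open>
  Segner's recurrence for the Catalan numbers, aerated with zeros, from their two-term recurrence.
  The two-term recurrence is a linear differential equation for the generating function \<open>M\<close>.  In
  terms of the square root \<open>D = 1 - 2 x\<^sup>2 M\<close> of the discriminant it says that \<open>D\<^sup>2\<close> and \<open>1 - 4 x\<^sup>2\<close>
  have the same logarithmic derivative.  Hence they agree, and this is the quadratic equation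
  \<open>M = 1 + x\<^sup>2 M\<^sup>2\<close>, whose coefficients are the convolution.
\<close>
lemma convolution_from_recurrence:
  fixes m :: "nat \<Rightarrow> real"
  assumes m0: "m 0 = 1" and m1: "m (Suc 0) = 0"
    and rec: "\<And>n. (real n + 4) * m (n + 2) = 4 * (real n + 1) * m n"
  shows "m (n + 2) = (\<Sum>i\<le>n. m i * m (n - i))"
proof -
  define M where "M = Abs_fps m"
  define X2 :: "real fps" where "X2 = fps_X * fps_X"
  define D where "D = 1 - 2 * X2 * M"
  define P where "P = 1 - 4 * X2"
  have dX2: "fps_deriv X2 = 2 * fps_X" by (simp add: X2_def)
  have ode: "fps_X * (fps_deriv M - 4 * (fps_X * (fps_X * fps_deriv M))) =
      2 - 2 * M + 4 * (fps_X * (fps_X * M))"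
  proof (rule fps_ext)
    fix n
    consider "n = 0" | "n = 1" | k where "n = Suc (Suc k)" by (metis One_nat_def not0_implies_Suc)
    then show "fps_nth (fps_X * (fps_deriv M - 4 * (fps_X * (fps_X * fps_deriv M)))) n =
        fps_nth (2 - 2 * M + 4 * (fps_X * (fps_X * M))) n"
    proof cases
      case 3
      then show ?thesis
        using rec[of k] by (cases k) (simp_all add: M_def numeral_fps_const algebra_simps)
    qed (simp_all add: M_def m0 m1 numeral_fps_const)
  qed
  have "P * fps_deriv D = - 2 * (2 * fps_X * M * P + fps_X * (fps_X * (fps_deriv M - 4 * (fps_X * (fps_X * fps_deriv M)))))"
    by (simp add: D_def P_def dX2) (simp add: X2_def algebra_simps)
  also have "\<dots> = - 4 * fps_X * D"
    unfolding ode by (simp add: D_def P_def X2_def algebra_simps)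
  finally have D': "P * fps_deriv D = - 4 * fps_X * D" .
  have dP: "fps_deriv P = - 8 * fps_X" by (simp add: P_def dX2)
  have P0: "fps_nth P 0 \<noteq> 0" by (simp add: P_def X2_def)
  have PI: "P * inverse P = 1" using P0 by (simp add: inverse_mult_eq_1')
  have "fps_deriv (D * D * inverse P) = 2 * D * (P * inverse P) * fps_deriv D * inverse P - D * D * fps_deriv P * (inverse P)\<^sup>2"
    using P0 by (simp add: fps_inverse_deriv PI algebra_simps)
  also have "\<dots> = 2 * D * (P * fps_deriv D) * (inverse P)\<^sup>2 - D * D * fps_deriv P * (inverse P)\<^sup>2"
    by (simp add: power2_eq_square algebra_simps)
  also have "\<dots> = 0"
    unfolding D' dP by (simp add: algebra_simps)
  finally have "D * D * inverse P = fps_const (fps_nth (D * D * inverse P) 0)"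
    by (rule iffD1[OF fps_deriv_eq_0_iff])
  also have "fps_nth (D * D * inverse P) 0 = 1"
    by (simp add: D_def P_def X2_def)
  finally have DI: "D * D * inverse P = 1" by simp
  have "D * D = D * D * (P * inverse P)" using PI by simp
  also have "\<dots> = D * D * inverse P * P" by (simp only: mult_ac)
  finally have "D * D = P" using DI by simp
  then have "4 * X2 * (1 + X2 * (M * M) - M) = 0"
    by (simp add: D_def P_def algebra_simps)
  then have "M = 1 + X2 * (M * M)" by (simp add: X2_def)
  then have "fps_nth M (n + 2) = fps_nth (1 + X2 * (M * M)) (n + 2)" by (rule arg_cong)
  also have "\<dots> = fps_nth (M * M) n" by (simp add: X2_def mult.assoc)
  finally show ?thesis by (simp add: M_def fps_mult_nth atMost_atLeast0)
qed

lemma semicircle_moment_convolution: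
  "semicircle_moment (n + 2) = (\<Sum>i\<le>n. semicircle_moment i * semicircle_moment (n - i))"
  by (rule convolution_from_recurrence[OF semicircle_moment_0 semicircle_moment_1])
    (use semicircle_moment_recurrence[of "Suc n" for n] in \<open>simp add: algebra_simps\<close>)

section \<open>The Schwinger--Dyson equation of the semicircular law\<close>

definition diff_quot :: "(real \<Rightarrow> real) \<Rightarrow> real \<times> real \<Rightarrow> real" where
  "diff_quot F z = (F (fst z) - F (snd z)) / (fst z - snd z)"

lemma measurable_diff_quot [measurable]:
  assumes [measurable]: "F \<in> borel_measurable borel"
  shows "diff_quot F \<in> borel_measurable (semicircle \<Otimes>\<^sub>M semicircle)"
  unfolding diff_quot_def by measurable

lemma diff_quot_bound:
  fixes F F' :: "real \<Rightarrow> real"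
  assumes "\<And>x. x \<in> {-2..2} \<Longrightarrow> (F has_real_derivative F' x) (at x)"
    and "\<And>x. x \<in> {-2..2} \<Longrightarrow> \<bar>F' x\<bar> \<le> B"
    and "fst z \<in> {-2..2}" "snd z \<in> {-2..2}" "fst z \<noteq> snd z"
  shows "\<bar>diff_quot F z\<bar> \<le> B"
proof -
  have "norm (F (fst z) - F (snd z)) \<le> B * norm (fst z - snd z)"
    by (rule field_differentiable_bound[where S = "{-2..2}" and f' = F'])
      (use assms in \<open>auto intro: has_field_derivative_at_within\<close>)
  then show ?thesis using assms(5) by (simp add: diff_quot_def field_simps)
qed

lemma AE_semicircle_pair:
  "AE z in semicircle \<Otimes>\<^sub>M semicircle.
     fst z \<in> {-2<..<2} \<and> snd z \<in> {-2<..<2} \<and> fst z \<noteq> snd z"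
  using AE_pair_self[OF prob_space_semicircle AE_semicircle_interval] AE_semicircle_pair_distinct
  by eventually_elim auto

lemma AE_diff_quot_bound:
  fixes F F' :: "real \<Rightarrow> real"
  assumes "\<And>x. x \<in> {-2..2} \<Longrightarrow> (F has_real_derivative F' x) (at x)"
    and "\<And>x. x \<in> {-2..2} \<Longrightarrow> \<bar>F' x\<bar> \<le> B"
  shows "AE z in semicircle \<Otimes>\<^sub>M semicircle. \<bar>diff_quot F z\<bar> \<le> B"
  using AE_semicircle_pair
proof eventually_elim
  case (elim z)
  then show ?case by (intro diff_quot_bound[OF assms]) auto
qed

lemma abs_integral_le_AE:
  fixes f :: "'a \<Rightarrow> real"
  assumes "prob_space M" "f \<in> borel_measurable M" "AE x in M. \<bar>f x\<bar> \<le> B"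
  shows "\<bar>\<integral>x. f x \<partial>M\<bar> \<le> B"
proof -
  interpret prob_space M by fact
  have int: "integrable M f" by (rule integrable_bounded_AE[OF assms])
  have "\<bar>\<integral>x. f x \<partial>M\<bar> \<le> (\<integral>x. \<bar>f x\<bar> \<partial>M)" by (rule integral_abs_bound)
  also have "\<dots> \<le> (\<integral>x. B \<partial>M)"
    by (rule integral_mono_AE) (use int assms in auto)
  finally show ?thesis by (simp add: prob_space)
qed

lemma integrable_semicircle_pair_bounded:
  assumes "f \<in> borel_measurable (semicircle \<Otimes>\<^sub>M semicircle)"
    and "AE z in semicircle \<Otimes>\<^sub>M semicircle. \<bar>f z\<bar> \<le> (B::real)"
  shows "integrable (semicircle \<Otimes>\<^sub>M semicircle) f"
  by (rule integrable_bounded_AE[OF prob_space_pair_self[OF prob_space_semicircle] assms])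

lemma integral_semicircle_pair_monomial:
  "integrable (semicircle \<Otimes>\<^sub>M semicircle) (\<lambda>z. fst z ^ i * snd z ^ j)" (is ?int)
  "(\<integral>z. fst z ^ i * snd z ^ j \<partial>(semicircle \<Otimes>\<^sub>M semicircle)) =
    semicircle_moment i * semicircle_moment j" (is ?eq)
proof -
  interpret prob_space semicircle by (rule prob_space_semicircle)
  interpret P: pair_prob_space semicircle semicircle ..
  show int: ?int
  proof (rule integrable_semicircle_pair_bounded)
    show "AE z in semicircle \<Otimes>\<^sub>M semicircle. \<bar>fst z ^ i * snd z ^ j\<bar> \<le> 2 ^ i * 2 ^ j"
      using AE_semicircle_pair
      by eventually_elim (auto simp: abs_mult power_abs intro!: mult_mono power_mono)
  qed measurable
  have "(\<integral>z. fst z ^ i * snd z ^ j \<partial>(semicircle \<Otimes>\<^sub>M semicircle)) =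
      (\<integral>x. \<integral>y. x ^ i * y ^ j \<partial>semicircle \<partial>semicircle)"
    using P.integral_fst'[OF int] by simp
  then show ?eq by (simp add: semicircle_moment_def)
qed

lemma diff_quot_power:
  assumes "fst z \<noteq> snd z"
  shows "diff_quot (\<lambda>x. x ^ Suc n) z = (\<Sum>i\<le>n. fst z ^ i * snd z ^ (n - i))"
proof -
  have "fst z ^ Suc n - snd z ^ Suc n = (fst z - snd z) * (\<Sum>i\<le>n. fst z ^ i * snd z ^ (n - i))"
    using diff_power_eq_sum[of "fst z" n "snd z"] by (simp add: lessThan_Suc_atMost)
  then show ?thesis using assms by (simp add: diff_quot_def)
qed

text \<open>
  The difference quotient of \<open>x\<^sup>i\<^sup>+\<^sup>1\<close> is \<open>\<Sum>j\<le>i. x\<^sup>j y\<^sup>i\<^sup>-\<^sup>j\<close>, so on a monomial the equation is the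
  convolution formula for the moments.  Constants contribute nothing to either side.
\<close>
lemma semicircle_Schwinger_Dyson_polynomial:
  fixes c :: "nat \<Rightarrow> real" and n :: nat
  defines "F \<equiv> \<lambda>x. \<Sum>i\<le>n. c i * x ^ Suc i"
  shows "(\<integral>z. diff_quot F z \<partial>(semicircle \<Otimes>\<^sub>M semicircle)) = (\<integral>x. x * F x \<partial>semicircle)"
proof -
  have "AE z in semicircle \<Otimes>\<^sub>M semicircle.
      diff_quot F z = (\<Sum>i\<le>n. c i * (\<Sum>j\<le>i. fst z ^ j * snd z ^ (i - j)))"
    using AE_semicircle_pair_distinct
  proof eventually_elim
    case (elim z)
    have "diff_quot F z = (\<Sum>i\<le>n. c i * diff_quot (\<lambda>x. x ^ Suc i) z)"
      unfolding F_def diff_quot_def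
      by (simp add: sum_subtractf[symmetric] sum_divide_distrib right_diff_distrib)
    then show ?case using diff_quot_power[OF elim] by (simp del: power_Suc)
  qed
  then have "(\<integral>z. diff_quot F z \<partial>(semicircle \<Otimes>\<^sub>M semicircle)) =
      (\<integral>z. (\<Sum>i\<le>n. c i * (\<Sum>j\<le>i. fst z ^ j * snd z ^ (i - j))) \<partial>(semicircle \<Otimes>\<^sub>M semicircle))"
    by (intro integral_cong_AE) (simp_all add: F_def)
  also have "\<dots> = (\<Sum>i\<le>n. c i * (\<Sum>j\<le>i. semicircle_moment j * semicircle_moment (i - j)))"
    by (simp add: Bochner_Integration.integral_sum integral_semicircle_pair_monomial)
  also have "\<dots> = (\<Sum>i\<le>n. c i * semicircle_moment (i + 2))"
    by (simp only: semicircle_moment_convolution)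
  also have "\<dots> = (\<integral>x. (\<Sum>i\<le>n. c i * x ^ (i + 2)) \<partial>semicircle)"
    unfolding semicircle_moment_def
    by (subst Bochner_Integration.integral_sum)
      (auto intro!: integrable_semicircle_continuous continuous_intros)
  also have "\<dots> = (\<integral>x. x * F x \<partial>semicircle)"
    unfolding F_def by (simp add: sum_distrib_left mult_ac)
  finally show ?thesis .
qed

lemma integral_semicircle_id: "(\<integral>x. x \<partial>semicircle) = 0"
  using semicircle_moment_1 by (simp add: semicircle_moment_def)

lemma integral_semicircle_square: "(\<integral>x. x\<^sup>2 \<partial>semicircle) = 1"
  using semicircle_moment_2 by (simp add: semicircle_moment_def)

lemma integrable_semicircle_bounded:
  assumes "f \<in> borel_measurable borel" "\<And>x. -2 < x \<Longrightarrow> x < 2 \<Longrightarrow> \<bar>f x\<bar> \<le> (B::real)"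
  shows "integrable semicircle f" "\<bar>\<integral>x. f x \<partial>semicircle\<bar> \<le> B"
proof -
  have *: "AE x in semicircle. \<bar>f x\<bar> \<le> B"
    using AE_semicircle_interval by eventually_elim (use assms in auto)
  show "integrable semicircle f"
    by (rule integrable_bounded_AE[OF prob_space_semicircle _ *]) (use assms in simp)
  show "\<bar>\<integral>x. f x \<partial>semicircle\<bar> \<le> B"
    by (rule abs_integral_le_AE[OF prob_space_semicircle _ *]) (use assms in simp)
qed

text \<open>
  Both sides of the Schwinger--Dyson equation are controlled by the derivative of the test function
  alone: the difference quotient by the mean value theorem, and \<open>\<integral> x F x\<close> because \<open>F\<close> may be
  replaced by \<open>F - F 0\<close>, the law being centered.  The equation is therefore stable under uniform
  approximation of derivatives.
\<close>
lemma Schwinger_Dyson_defect_bound: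
  fixes F F' :: "real \<Rightarrow> real"
  assumes [measurable]: "F \<in> borel_measurable borel"
    and F: "\<And>x. x \<in> {-2..2} \<Longrightarrow> (F has_real_derivative F' x) (at x)"
    and F': "\<And>x. x \<in> {-2..2} \<Longrightarrow> \<bar>F' x\<bar> \<le> B"
  shows "integrable (semicircle \<Otimes>\<^sub>M semicircle) (diff_quot F)" "integrable semicircle (\<lambda>x. x * F x)"
    "\<bar>(\<integral>z. diff_quot F z \<partial>(semicircle \<Otimes>\<^sub>M semicircle)) - (\<integral>x. x * F x \<partial>semicircle)\<bar> \<le> 5 * B"
proof -
  note q = AE_diff_quot_bound[OF F F']
  show "integrable (semicircle \<Otimes>\<^sub>M semicircle) (diff_quot F)"
    by (rule integrable_semicircle_pair_bounded[OF _ q]) simp_all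
  have osc: "\<bar>F x - F 0\<bar> \<le> 2 * B" if "-2 < x" "x < 2" for x
  proof -
    have "norm (F x - F 0) \<le> B * norm (x - 0)"
      by (rule field_differentiable_bound[where S = "{-2..2}" and f' = F'])
        (use F F' that in \<open>auto intro: has_field_derivative_at_within\<close>)
    also have "\<dots> \<le> B * 2"
      using that F'[of 0] by (intro mult_left_mono) auto
    finally show ?thesis by simp
  qed
  have "\<bar>x * (F x - F 0)\<bar> \<le> 2 * (2 * B)" if "-2 < x" "x < 2" for x
    unfolding abs_mult using osc[OF that] that by (intro mult_mono) auto
  note c = integrable_semicircle_bounded[OF _ this, simplified]
  have c1: "integrable semicircle (\<lambda>x. x * (F x - F 0))" by (rule c(1); simp)
  have c2: "\<bar>\<integral>x. x * (F x - F 0) \<partial>semicircle\<bar> \<le> 4 * B" by (rule c(2); simp)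
  have id: "integrable semicircle (\<lambda>x. x * F 0)"
    by (intro integrable_semicircle_continuous continuous_intros)
  have eq: "(\<lambda>x. x * F x) = (\<lambda>x. x * (F x - F 0) + x * F 0)" by (auto simp: algebra_simps)
  show "integrable semicircle (\<lambda>x. x * F x)"
    unfolding eq by (rule Bochner_Integration.integrable_add[OF c1 id])
  have "(\<integral>x. x * F x \<partial>semicircle) = (\<integral>x. x * (F x - F 0) \<partial>semicircle)"
    unfolding eq using c1 id by (simp add: integral_semicircle_id)
  moreover have "\<bar>\<integral>z. diff_quot F z \<partial>(semicircle \<Otimes>\<^sub>M semicircle)\<bar> \<le> B"
    by (rule abs_integral_le_AE[OF prob_space_pair_self[OF prob_space_semicircle] _ q]) simp_all
  ultimately show "\<bar>(\<integral>z. diff_quot F z \<partial>(semicircle \<Otimes>\<^sub>M semicircle)) - (\<integral>x. x * F x \<partial>semicircle)\<bar> \<le> 5 * B"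
    using c2 by linarith
qed

lemma semicircle_Schwinger_Dyson_C1:
  fixes F F' :: "real \<Rightarrow> real"
  assumes [measurable]: "F \<in> borel_measurable borel"
    and F: "\<And>x. x \<in> {-2..2} \<Longrightarrow> (F has_real_derivative F' x) (at x)"
    and F': "continuous_on {-2..2} F'"
  shows "integrable (semicircle \<Otimes>\<^sub>M semicircle) (diff_quot F)"
    "(\<integral>z. diff_quot F z \<partial>(semicircle \<Otimes>\<^sub>M semicircle)) = (\<integral>x. x * F x \<partial>semicircle)"
proof -
  obtain B where "\<And>x. x \<in> {-2..2} \<Longrightarrow> \<bar>F' x\<bar> \<le> B"
    using continuous_on_compact_abs_bound[OF compact_Icc F'] by blast
  note int_F = Schwinger_Dyson_defect_bound(1,2)[OF _ F this, simplified]
  show int1: "integrable (semicircle \<Otimes>\<^sub>M semicircle) (diff_quot F)" by (rule int_F; simp)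
  have int2: "integrable semicircle (\<lambda>x. x * F x)" by (rule int_F; simp)
  have "\<bar>(\<integral>z. diff_quot F z \<partial>(semicircle \<Otimes>\<^sub>M semicircle)) - (\<integral>x. x * F x \<partial>semicircle)\<bar> \<le> 0 + e"
    if "e > 0" for e
  proof -
    \<comment> \<open>Only the derivatives are matched: the polynomial \<open>P\<close> below approximates \<open>F\<close> only up to a constant.\<close>
    obtain g where "real_polynomial_function g" and g: "\<And>x. x \<in> {-2..2} \<Longrightarrow> \<bar>F' x - g x\<bar> < e / 5"
      using Stone_Weierstrass_real_polynomial_function[OF _ F', of "e / 5"] \<open>e > 0\<close> by auto
    then obtain a n where ga: "g = (\<lambda>x. \<Sum>i\<le>n. a i * x ^ i)"
      unfolding real_polynomial_function_iff_sum by blast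
    define P where "P = (\<lambda>x. \<Sum>i\<le>n. a i / real (Suc i) * x ^ Suc i)"
    have P: "(P has_real_derivative g x) (at x)" for x
      unfolding P_def ga
      by (rule DERIV_sum, rule DERIV_cong[OF DERIV_cmult[OF DERIV_pow]]) (simp del: of_nat_Suc)
    have [measurable]: "P \<in> borel_measurable borel"
      unfolding P_def by measurable
    have "continuous_on {-2..2} g" unfolding ga by (intro continuous_intros)
    then obtain C where "\<And>x. x \<in> {-2..2} \<Longrightarrow> \<bar>g x\<bar> \<le> C"
      using continuous_on_compact_abs_bound[OF compact_Icc] by blast
    note int_P' = Schwinger_Dyson_defect_bound(1,2)[OF _ P this, simplified]
    have int_P1: "integrable (semicircle \<Otimes>\<^sub>M semicircle) (diff_quot P)" by (rule int_P'; simp)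
    have int_P2: "integrable semicircle (\<lambda>x. x * P x)" by (rule int_P'; simp)
    have "\<bar>(\<integral>z. diff_quot (\<lambda>x. F x - P x) z \<partial>(semicircle \<Otimes>\<^sub>M semicircle)) -
        (\<integral>x. x * (F x - P x) \<partial>semicircle)\<bar> \<le> 5 * (e / 5)"
      by (rule Schwinger_Dyson_defect_bound(3)[where F' = "\<lambda>x. F' x - g x"])
        (use F P g in \<open>auto intro!: derivative_intros less_imp_le\<close>)
    moreover have "diff_quot (\<lambda>x. F x - P x) = (\<lambda>z. diff_quot F z - diff_quot P z)"
      unfolding diff_quot_def by (auto simp: diff_divide_distrib[symmetric])
    moreover have "(\<integral>z. diff_quot P z \<partial>(semicircle \<Otimes>\<^sub>M semicircle)) = (\<integral>x. x * P x \<partial>semicircle)"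
      unfolding P_def by (rule semicircle_Schwinger_Dyson_polynomial)
    ultimately show ?thesis
      by (simp add: right_diff_distrib int1 int2 int_P1 int_P2)
  qed
  then have "\<bar>(\<integral>z. diff_quot F z \<partial>(semicircle \<Otimes>\<^sub>M semicircle)) - (\<integral>x. x * F x \<partial>semicircle)\<bar> \<le> 0"
    by (rule field_le_epsilon)
  then show "(\<integral>z. diff_quot F z \<partial>(semicircle \<Otimes>\<^sub>M semicircle)) = (\<integral>x. x * F x \<partial>semicircle)"
    by simp
qed

text \<open>
  On the open interval the derivative may blow up at the endpoints.  The contractions \<open>F (r x)\<close> with
  \<open>r < 1\<close> are \<open>C\<^sup>1\<close> up to the endpoints; monotonicity makes the difference quotients nonnegative, so
  that Fatou's lemma applies as \<open>r\<close> tends to 1, at the price of an inequality.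
\<close>
lemma semicircle_Schwinger_Dyson_mono:
  fixes F F' :: "real \<Rightarrow> real"
  assumes [measurable]: "F \<in> borel_measurable borel"
    and F: "\<And>x. x \<in> {-2<..<2} \<Longrightarrow> (F has_real_derivative F' x) (at x)"
    and F': "continuous_on {-2<..<2} F'"
    and mono: "mono_on {-2<..<2} F"
    and bound: "\<And>x. x \<in> {-2<..<2} \<Longrightarrow> \<bar>F x\<bar> \<le> B"
  shows "integrable (semicircle \<Otimes>\<^sub>M semicircle) (diff_quot F)"
    "(\<integral>z. diff_quot F z \<partial>(semicircle \<Otimes>\<^sub>M semicircle)) \<le> (\<integral>x. x * F x \<partial>semicircle)"
proof -
  define r where "r n = real (Suc n) / real (n + 2)" for n
  have r: "0 < r n" "r n < 1" for n by (auto simp: r_def)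
  have r1: "r \<longlonglongrightarrow> 1" unfolding r_def by real_asymp
  define G where "G n x = F (r n * x)" for n x
  have [measurable]: "G n \<in> borel_measurable borel" for n unfolding G_def by measurable
  have rx: "r n * x \<in> {-2<..<2}" if "x \<in> {-2..2}" for n x
  proof -
    have "\<bar>r n * x\<bar> \<le> r n * 2"
      unfolding abs_mult using r[of n] that by (intro mult_mono) auto
    also have "\<dots> < 2" using r[of n] by simp
    finally show ?thesis by (auto simp: abs_less_iff)
  qed
  have G: "(G n has_real_derivative F' (r n * x) * r n) (at x)" if "x \<in> {-2..2}" for n x
    unfolding G_def
    by (rule DERIV_chain2[where f = F and g = "\<lambda>x. r n * x", OF F[OF rx[OF that]]]) (auto intro!: derivative_eq_intros)
  have G': "continuous_on {-2..2} (\<lambda>x. F' (r n * x) * r n)" for n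
    by (intro continuous_intros continuous_on_compose2[OF F']) (use rx in auto)
  note SD = semicircle_Schwinger_Dyson_C1[OF _ G G', simplified]
  have SD1: "integrable (semicircle \<Otimes>\<^sub>M semicircle) (diff_quot (G n))" for n by (rule SD; simp)
  have SD2: "(\<integral>z. diff_quot (G n) z \<partial>(semicircle \<Otimes>\<^sub>M semicircle)) = (\<integral>x. x * G n x \<partial>semicircle)" for n
    by (rule SD; simp)
  have conv: "(\<lambda>n. G n x) \<longlonglongrightarrow> F x" if "x \<in> {-2<..<2}" for x
  proof -
    have "(\<lambda>n. r n * x) \<longlonglongrightarrow> 1 * x" by (intro tendsto_intros r1)
    then show ?thesis
      unfolding G_def using isCont_tendsto_compose[OF DERIV_isCont[OF F[OF that]], of "\<lambda>n. r n * x"] by simp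
  qed
  have lower: "AE z in semicircle \<Otimes>\<^sub>M semicircle. - 0 \<le> diff_quot (G n) z" for n
    using AE_semicircle_pair
  proof eventually_elim
    case (elim z)
    have *: "G n x \<le> G n y" if "x \<le> y" "x \<in> {-2..2}" "y \<in> {-2..2}" for x y
      unfolding G_def using that r(1)[of n] rx
      by (intro mono_onD[OF mono]) (auto intro!: mult_left_mono)
    show ?case
      using *[of "fst z" "snd z"] *[of "snd z" "fst z"] elim
      by (cases "fst z \<le> snd z") (auto simp: diff_quot_def intro: divide_nonneg_nonneg divide_nonpos_nonpos)
  qed
  have lim: "AE z in semicircle \<Otimes>\<^sub>M semicircle. (\<lambda>n. diff_quot (G n) z) \<longlonglongrightarrow> diff_quot F z"
    using AE_semicircle_pair
    by eventually_elim (auto simp: diff_quot_def intro!: tendsto_intros conv)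
  have "(\<lambda>n. \<integral>x. x * G n x \<partial>semicircle) \<longlonglongrightarrow> (\<integral>x. x * F x \<partial>semicircle)"
  proof (rule integral_dominated_convergence[where w = "\<lambda>_. 2 * B"])
    show "AE x in semicircle. (\<lambda>n. x * G n x) \<longlonglongrightarrow> x * F x"
      using AE_semicircle_interval by eventually_elim (auto intro!: tendsto_intros conv)
    show "AE x in semicircle. norm (x * G n x) \<le> 2 * B" for n
      using AE_semicircle_interval
      by eventually_elim (use bound rx in \<open>auto simp: abs_mult G_def intro!: mult_mono\<close>)
    interpret prob_space semicircle by (rule prob_space_semicircle)
    show "integrable semicircle (\<lambda>_. 2 * B)" by simp
  qed simp_all
  note Fatou = Fatou_bounded_below[OF prob_space_pair_self[OF prob_space_semicircle] SD1 _ lower lim eq_refl[OF SD2] this]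
  show "integrable (semicircle \<Otimes>\<^sub>M semicircle) (diff_quot F)"
    "(\<integral>z. diff_quot F z \<partial>(semicircle \<Otimes>\<^sub>M semicircle)) \<le> (\<integral>x. x * F x \<partial>semicircle)"
    by (rule Fatou; simp)+
qed

section \<open>Rigidity of the transport map\<close>

text \<open>
  If \<open>T\<close> decreased from \<open>x\<close> to \<open>y\<close>, then by continuity it would also do so from points of \<open>A\<close> just to
  the right of \<open>x\<close> to points of \<open>A\<close> just to the left of \<open>y\<close>.
\<close>
lemma semicircle_mono_on_full_measure_imp_mono_on:
  fixes T :: "real \<Rightarrow> real"
  assumes full: "AE x in semicircle. x \<in> A" and mono: "mono_on A T"
    and cont: "continuous_on {-2<..<2} T"
  shows "mono_on {-2<..<2} T"
proof (rule mono_onI, rule ccontr)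
  fix x y :: real
  assume x: "x \<in> {-2<..<2}" and y: "y \<in> {-2<..<2}" and "x \<le> y" and "\<not> T x \<le> T y"
  then have xy: "x < y" "T y < T x" by (auto simp: order_le_less)
  define c where "c = (T x + T y) / 2"
  have c: "T y < c" "c < T x" using xy by (auto simp: c_def)
  have isCont: "isCont T z" if "z \<in> {-2<..<2}" for z
    using cont that by (simp add: continuous_on_eq_continuous_at)
  have "\<forall>\<^sub>F z in at_right x. c < T z"
    using order_tendstoD(1)[OF isCont[OF x, unfolded isCont_def] c(2)] by (rule filter_leD[OF at_le, rotated]) simp
  then obtain b where b: "b > x" "\<And>z. x < z \<Longrightarrow> z < b \<Longrightarrow> c < T z"
    unfolding eventually_at_right_field by blast
  have "\<forall>\<^sub>F z in at_left y. T z < c"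
    using order_tendstoD(2)[OF isCont[OF y, unfolded isCont_def] c(1)] by (rule filter_leD[OF at_le, rotated]) simp
  then obtain a where a: "a < y" "\<And>z. a < z \<Longrightarrow> z < y \<Longrightarrow> T z < c"
    unfolding eventually_at_left_field by blast
  define m where "m = (x + y) / 2"
  have m: "x < m" "m < y" using xy by (auto simp: m_def)
  have "min b m \<le> 2" using m y by (simp add: min_le_iff_disj)
  then obtain p where p: "x < p" "p < min b m" "p \<in> A"
    using semicircle_full_measure_dense[OF full, of x "min b m"] x y m b(1) by auto
  have "-2 \<le> max a m" using m x by (simp add: le_max_iff_disj)
  then obtain q where q: "max a m < q" "q < y" "q \<in> A"
    using semicircle_full_measure_dense[OF full, of "max a m" y] x y m a(1) by auto
  have "T p \<le> T q" using p q by (intro mono_onD[OF mono]) auto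
  moreover have "c < T p" using p by (intro b(2)) auto
  moreover have "T q < c" using q by (intro a(2)) auto
  ultimately show False by simp
qed

lemma semicircle_AE_bound_imp_bound:
  fixes T :: "real \<Rightarrow> real"
  assumes full: "AE x in semicircle. \<bar>T x\<bar> \<le> B"
    and cont: "continuous_on {-2<..<2} T" and x: "x \<in> {-2<..<2}"
  shows "\<bar>T x\<bar> \<le> B"
proof (rule ccontr)
  assume "\<not> \<bar>T x\<bar> \<le> B"
  then have "B < \<bar>T x\<bar>" by simp
  moreover have "isCont (\<lambda>z. \<bar>T z\<bar>) x"
    using cont x by (intro continuous_intros) (simp add: continuous_on_eq_continuous_at)
  ultimately have "\<forall>\<^sub>F z in at x. B < \<bar>T z\<bar>"
    unfolding isCont_def by (rule order_tendstoD(1)[rotated])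
  then have "\<forall>\<^sub>F z in at_right x. B < \<bar>T z\<bar>"
    by (rule filter_leD[OF at_le, rotated]) simp
  then obtain b where b: "b > x" "\<And>z. x < z \<Longrightarrow> z < b \<Longrightarrow> B < \<bar>T z\<bar>"
    unfolding eventually_at_right_field by blast
  obtain p where "x < p" "p < min b 2" "\<bar>T p\<bar> \<le> B"
    using semicircle_full_measure_dense[OF full, of x "min b 2"] x b(1) by auto
  then show False using b(2)[of p] by auto
qed

text \<open>
  The variance equals the value 1 that the scaling \<open>Y = - X\<close> gives as an upper bound for
  \<open>\<integral> u'(X) X\<close>, whereas \<open>u'' \<ge> 1\<close> pushes this integral above the variance.  The lower bound on the
  convexity is therefore saturated along the law of \<open>X\<close>.
\<close>
lemma minimizer_potential_gradient:
  fixes X :: "'a \<Rightarrow> real" and u u' u'' :: "real \<Rightarrow> real"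
  assumes p: "prob_space M" and [measurable]: "X \<in> borel_measurable M"
    and X: "AE x in M. \<bar>X x\<bar> \<le> R"
    and u: "\<And>x. (u has_real_derivative u' x) (at x)"
    and u': "\<And>x. (u' has_real_derivative u'' x) (at x)"
    and u'': "\<And>x. u'' x \<ge> 1"
    and min: "is_energy_minimizer u (distr M borel X)"
    and mean: "(\<integral>x. X x \<partial>M) = 0" and var: "(\<integral>x. (X x)\<^sup>2 \<partial>M) = 1"
  shows "AE x in M. u' (X x) = X x"
proof -
  interpret prob_space M by fact
  interpret P: prob_space "M \<Otimes>\<^sub>M M" by (rule prob_space_pair_self) fact
  have cont_u: "continuous_on UNIV u"
    using u by (rule DERIV_imp_continuous_on)
  have cont: "continuous_on UNIV u'"
    using u' by (rule DERIV_imp_continuous_on)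
  have int: "integrable M (\<lambda>x. h (X x))" if "continuous_on UNIV h" for h :: "real \<Rightarrow> real"
    by (rule integrable_continuous_bounded[OF p _ X that]) simp
  note var1 = minimizer_first_variation(2)[OF p _ _ X _ u cont min]
  \<comment> \<open>Translations in both directions balance the mean force.\<close>
  have "(\<integral>z. (1 - 1) / (X (fst z) - X (snd z)) \<partial>(M \<Otimes>\<^sub>M M)) \<le> (\<integral>x. u' (X x) * 1 \<partial>M)"
    by (rule var1[where K = 0 and S = 1]) simp_all
  moreover have "(\<integral>z. (- 1 - (- 1)) / (X (fst z) - X (snd z)) \<partial>(M \<Otimes>\<^sub>M M)) \<le> (\<integral>x. u' (X x) * (- 1) \<partial>M)"
    by (rule var1[where K = 0 and S = 1]) simp_all
  ultimately have mean_u': "(\<integral>x. u' (X x) \<partial>M) = 0" by simp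
  have "free_energy u (distr M borel X) \<noteq> \<infinity>"
    using ex_finite_free_energy[OF cont_u] min unfolding is_energy_minimizer_def by fastforce
  then have distinct: "AE z in M \<Otimes>\<^sub>M M. X (fst z) \<noteq> X (snd z)"
    using finite_free_energyD(1)[OF p _ X cont_u] by simp
  let ?q = "\<lambda>z. (- X (fst z) - - X (snd z)) / (X (fst z) - X (snd z))"
  have q: "AE z in M \<Otimes>\<^sub>M M. ?q z = - 1"
    using distinct by eventually_elim (simp add: field_simps)
  \<comment> \<open>Contracting towards 0 changes all distances by the same factor, so \<open>q\<close> is the constant \<open>- 1\<close>.\<close>
  have "(\<integral>z. ?q z \<partial>(M \<Otimes>\<^sub>M M)) \<le> (\<integral>x. u' (X x) * - X x \<partial>M)"
    by (rule var1[where K = 1 and S = R]) (use X q in \<open>auto elim: AE_mp\<close>)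
  moreover have "(\<integral>z. ?q z \<partial>(M \<Otimes>\<^sub>M M)) = (\<integral>z. - 1 \<partial>(M \<Otimes>\<^sub>M M))"
    by (rule integral_cong_AE) (use q in simp_all)
  ultimately have virial: "(\<integral>x. u' (X x) * X x \<partial>M) \<le> 1"
    by (simp add: P.prob_space)
  define g where "g t = u' t - t" for t
  have cont_g: "continuous_on UNIV g"
    unfolding g_def by (intro continuous_intros cont)
  have "mono g"
  proof (rule monoI)
    fix s t :: real assume "s \<le> t"
    then show "g s \<le> g t"
    proof (rule DERIV_nonneg_imp_nondecreasing)
      fix x
      have "(g has_real_derivative u'' x - 1) (at x)"
        unfolding g_def by (intro derivative_intros u')
      then show "\<exists>y. (g has_real_derivative y) (at x) \<and> 0 \<le> y" using u''[of x] by fastforce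
    qed
  qed
  \<comment> \<open>Comparing with \<open>g 0\<close>, instead of the mean of \<open>g\<close>, makes the integrand pointwise nonnegative;
      the correction integrates to 0 because \<open>X\<close> is centered.\<close>
  then have nn: "0 \<le> t * (g t - g 0)" for t
    using monoD[of g 0 t] monoD[of g t 0] by (cases "0 \<le> t") (auto intro: mult_nonpos_nonpos)
  have int_u'X: "integrable M (\<lambda>x. u' (X x) * X x)"
    by (rule int[of "\<lambda>t. u' t * t"]) (intro continuous_intros cont)
  have int_X: "integrable M X" "integrable M (\<lambda>x. (X x)\<^sup>2)" "integrable M (\<lambda>x. u' (X x))"
    using int[OF continuous_on_id] int[OF continuous_on_power[OF continuous_on_id, of _ 2]]
      int[OF cont] by simp_all
  have int_g: "integrable M (\<lambda>x. X x * (g (X x) - g 0))"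
    by (rule int[of "\<lambda>t. t * (g t - g 0)"]) (intro continuous_intros cont_g)
  have "(\<integral>x. X x * (g (X x) - g 0) \<partial>M) = (\<integral>x. u' (X x) * X x - (X x)\<^sup>2 - g 0 * X x \<partial>M)"
    by (intro Bochner_Integration.integral_cong) (simp_all add: g_def power2_eq_square algebra_simps)
  also have "\<dots> = (\<integral>x. u' (X x) * X x \<partial>M) - 1"
    using int_u'X int_X by (simp add: mean var)
  also have "\<dots> \<le> 0" using virial by simp
  finally have "(\<integral>x. X x * (g (X x) - g 0) \<partial>M) = 0"
    using integral_nonneg_AE[of "\<lambda>x. X x * (g (X x) - g 0)" M] nn by (simp add: order_antisym)
  then have "AE x in M. X x * (g (X x) - g 0) = 0"
    using integral_nonneg_eq_0_iff_AE[OF int_g] nn by simp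
  then have g0: "AE x in M. g (X x) = g 0" by eventually_elim auto
  have "(\<integral>x. g (X x) \<partial>M) = (\<integral>x. g 0 \<partial>M)"
    by (rule integral_cong_AE) (use g0 int[OF cont_g] in auto)
  moreover have "(\<integral>x. g (X x) \<partial>M) = 0"
    unfolding g_def using int_X by (simp add: mean mean_u')
  ultimately have "g 0 = 0" by (simp add: prob_space)
  then show ?thesis using g0 by (simp add: g_def)
qed

theorem corollary5:
  fixes u u' u'' T :: "real \<Rightarrow> real" and \<mu> :: "real measure"
  assumes "convex_on UNIV u"
    and "\<And>x. (u has_real_derivative u' x) (at x)"
    and "\<And>x. (u' has_real_derivative u'' x) (at x)"
    and "\<And>x. u'' x \<ge> 1"
    and "is_free_gibbs_measure u \<mu>"
    and "AE x in \<mu>. x \<in> {-2..2}"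
    and "(\<integral>x. x \<partial>\<mu>) = 0"
    and "prob_space.variance \<mu> (\<lambda>x. x) = 1"
    and "is_brenier_map semicircle \<mu> T"
    and "C3_on {-2<..<2} T"
  shows "\<mu> = semicircle"
proof -
  interpret S: prob_space semicircle by (rule prob_space_semicircle)
  interpret P: prob_space "semicircle \<Otimes>\<^sub>M semicircle"
    by (rule prob_space_pair_self[OF prob_space_semicircle])
  have meas [measurable]: "T \<in> borel_measurable borel" and \<mu>: "distr semicircle borel T = \<mu>"
    using assms(9) unfolding is_brenier_map_def is_transport_map_def
    by (auto simp: measurable_cong_sets[OF sets_semicircle refl])
  have T_meas [measurable]: "T \<in> borel_measurable semicircle" using meas by simp
  have min: "is_energy_minimizer u (distr semicircle borel T)"
    using assms(5) unfolding \<mu> is_free_gibbs_measure_def by blast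
  obtain T' T'' where T': "\<And>x. x \<in> {-2<..<2} \<Longrightarrow> (T has_real_derivative T' x) (at x)"
    and T'': "\<And>x. x \<in> {-2<..<2} \<Longrightarrow> (T' has_real_derivative T'' x) (at x)"
    using assms(10) unfolding C3_on_def by blast
  have cont_T: "continuous_on {-2<..<2} T" using T' by (rule DERIV_imp_continuous_on)
  have cont_T': "continuous_on {-2<..<2} T'" using T'' by (rule DERIV_imp_continuous_on)
  obtain A where "AE x in semicircle. x \<in> A" "mono_on A T"
    using assms(9) unfolding is_brenier_map_def by blast
  then have mono: "mono_on {-2<..<2} T"
    using cont_T by (rule semicircle_mono_on_full_measure_imp_mono_on)
  have T_bound: "AE x in semicircle. \<bar>T x\<bar> \<le> 2"
    using AE_distrD[OF T_meas, of "\<lambda>x. x \<in> {-2..2}"] assms(6) unfolding \<mu>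
    by (auto elim!: AE_mp)
  have bound: "\<bar>T x\<bar> \<le> 2" if "x \<in> {-2<..<2}" for x
    by (rule semicircle_AE_bound_imp_bound[OF T_bound cont_T that])
  have mean: "(\<integral>x. T x \<partial>semicircle) = 0"
    using assms(7) unfolding \<mu>[symmetric] by (simp add: integral_distr)
  have var: "(\<integral>x. (T x)\<^sup>2 \<partial>semicircle) = 1"
    using assms(8) unfolding assms(7) unfolding \<mu>[symmetric] by (simp add: integral_distr)
  have u': "continuous_on UNIV u'"
    using assms(3) by (rule DERIV_imp_continuous_on)
  have grad: "AE x in semicircle. u' (T x) = T x"
    by (rule minimizer_potential_gradient[OF prob_space_semicircle T_meas T_bound assms(2-4) min mean var])
  let ?q = "\<lambda>z. (fst z - snd z) / (T (fst z) - T (snd z))"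
  \<comment> \<open>The bound \<open>- 0\<close> is the instance \<open>K = 0\<close> of the lower bound in the first variation.\<close>
  have mono_q: "AE z in semicircle \<Otimes>\<^sub>M semicircle. - 0 \<le> ?q z"
    using AE_semicircle_pair
  proof eventually_elim
    case (elim z)
    then show ?case
      using mono_onD[OF mono, of "fst z" "snd z"] mono_onD[OF mono, of "snd z" "fst z"]
      by (cases "fst z \<le> snd z") (auto intro: divide_nonneg_nonneg divide_nonpos_nonpos)
  qed
  have id_bound: "AE x in semicircle. \<bar>x\<bar> \<le> 2"
    using AE_semicircle_interval by eventually_elim auto
  note var1 = minimizer_first_variation[OF prob_space_semicircle T_meas _ T_bound id_bound assms(2) u' min order_refl mono_q, simplified]
  have q_int: "integrable (semicircle \<Otimes>\<^sub>M semicircle) ?q"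
    and q_le: "(\<integral>z. ?q z \<partial>(semicircle \<Otimes>\<^sub>M semicircle)) \<le> (\<integral>x. u' (T x) * x \<partial>semicircle)"
    by (rule var1; simp)+
  have "(\<integral>x. u' (T x) * x \<partial>semicircle) = (\<integral>x. x * T x \<partial>semicircle)"
  proof (rule integral_cong_AE)
    have [measurable]: "u' \<in> borel_measurable borel" by (rule borel_measurable_continuous_onI[OF u'])
    show "(\<lambda>x. u' (T x) * x) \<in> borel_measurable semicircle" by simp
  qed (use grad in \<open>auto elim!: AE_mp\<close>)
  note q_le = q_le[unfolded this]
  note SD = semicircle_Schwinger_Dyson_mono[OF meas T' cont_T' mono bound, simplified]
  have d_int: "integrable (semicircle \<Otimes>\<^sub>M semicircle) (diff_quot T)"
    and d_le: "(\<integral>z. diff_quot T z \<partial>(semicircle \<Otimes>\<^sub>M semicircle)) \<le> (\<integral>x. x * T x \<partial>semicircle)"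
    by (rule SD; simp)+
  have cont_u: "continuous_on UNIV u"
    using assms(2) by (rule DERIV_imp_continuous_on)
  have "free_energy u (distr semicircle borel T) \<noteq> \<infinity>"
    using ex_finite_free_energy[OF cont_u] min unfolding is_energy_minimizer_def by fastforce
  then have distinct: "AE z in semicircle \<Otimes>\<^sub>M semicircle. T (fst z) \<noteq> T (snd z)"
    by (rule finite_free_energyD(1)[OF prob_space_semicircle T_meas T_bound cont_u])
  have "(\<integral>z. 2 \<partial>(semicircle \<Otimes>\<^sub>M semicircle)) \<le> (\<integral>z. diff_quot T z + ?q z \<partial>(semicircle \<Otimes>\<^sub>M semicircle))"
  proof (rule integral_mono_AE)
    show "AE z in semicircle \<Otimes>\<^sub>M semicircle. 2 \<le> diff_quot T z + ?q z"
      using distinct mono_q AE_semicircle_pair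
    proof eventually_elim
      case (elim z)
      define a where "a = diff_quot T z"
      have a: "?q z = 1 / a" "0 < a"
        using elim by (auto simp: a_def diff_quot_def zero_le_divide_iff zero_less_divide_iff)
      have "0 \<le> (a - 1)\<^sup>2 / a" using a by simp
      then have "2 \<le> a + 1 / a" using a(2) by (simp add: field_simps power2_eq_square)
      then show ?case by (simp only: a(1) a_def[symmetric])
    qed
  qed (use d_int q_int in simp_all)
  then have corr: "1 \<le> (\<integral>x. x * T x \<partial>semicircle)"
    using d_le q_le d_int q_int by (simp add: P.prob_space)
  have ints: "integrable semicircle (\<lambda>x. x\<^sup>2)" "integrable semicircle (\<lambda>x. (T x)\<^sup>2)"
      "integrable semicircle (\<lambda>x. x * T x)"
  proof -
    show "integrable semicircle (\<lambda>x. x\<^sup>2)"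
      by (intro integrable_semicircle_continuous continuous_intros)
    show "integrable semicircle (\<lambda>x. (T x)\<^sup>2)"
      by (rule integrable_continuous_bounded[OF prob_space_semicircle T_meas T_bound])
        (intro continuous_intros)
    have "\<bar>x * T x\<bar> \<le> 2 * 2" if "-2 < x" "x < 2" for x
      unfolding abs_mult using bound[of x] that by (intro mult_mono) auto
    then show "integrable semicircle (\<lambda>x. x * T x)"
      by (intro integrable_semicircle_bounded(1)) simp_all
  qed
  have exp: "(x - T x)\<^sup>2 = x\<^sup>2 - 2 * (x * T x) + (T x)\<^sup>2" for x
    by (simp add: power2_eq_square algebra_simps)
  have int_sq: "integrable semicircle (\<lambda>x. (x - T x)\<^sup>2)"
    unfolding exp using ints by simp
  have "(\<integral>x. (x - T x)\<^sup>2 \<partial>semicircle) = 2 - 2 * (\<integral>x. x * T x \<partial>semicircle)"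
    unfolding exp using ints by (simp add: var integral_semicircle_square)
  then have "(\<integral>x. (x - T x)\<^sup>2 \<partial>semicircle) = 0"
    using corr integral_nonneg_AE[of "\<lambda>x. (x - T x)\<^sup>2" semicircle] by simp
  then have "AE x in semicircle. (x - T x)\<^sup>2 = 0"
    using integral_nonneg_eq_0_iff_AE[OF int_sq] by simp
  then have "AE x in semicircle. T x = x" by eventually_elim simp
  then have "distr semicircle borel T = distr semicircle borel (\<lambda>x. x)"
    by (intro distr_cong_AE) simp_all
  also have "\<dots> = semicircle" by (rule distr_id2) simp
  finally show ?thesis unfolding \<mu> .
qed

end
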